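(* Let $(a_k)_{k\ge1}$ be any sequence of points of $\mathbb B$, and let $T_k=B^{(k-1)}*e_{a_k}$ for $k\ge1$. Then $\{T_k\}_{k\ge1}$ is an orthonormal system in $H^2(\mathbb B)$, i.e. $\langle T_k,T_k\rangle=1$ for all $k\ge1$ and $\langle T_k,T_l\rangle=0$ for all $k\ne l$.
   Context: $\mathbb H$ is the skew field of quaternions, $\mathbb S=\{I\in\mathbb H: I^2=-1\}$, $\mathbb C_I=\{x+yI:x,y\in\mathbb R\}$, and $\mathbb B$ is the open Euclidean unit ball of $\mathbb H$. A function $f:\mathbb B\to\mathbb H$ is a slice function if $f(x+yJ)=\frac12\big(f(x+yI)+f(x-yI)\big)+\frac{JI}{2}\big(f(x-yI)-f(x+yI)\big)$ for all $x,y\in\mathbb R$, $I,J\in\mathbb S$ with the points in $\mathbb B$. It is slice regular if it is a slice function and, for each $I\in\mathbb S$, the restriction $f_I$ of $f$ to $\mathbb B\cap\mathbb C_I$ has continuous partial derivatives and satisfies $\frac12(\partial_x+I\partial_y)f_I(x+yI)=0$. A slice regular function on $\mathbb B$ has a power series expansion $f(q)=\sum_{n\ge0}q^na_n$ with $a_n\in\mathbb H$. The $*$-product of $f=\sum q^na_n$ and $g=\sum q^nb_n$ is $(f*g)(q)=\sum_{n\ge0}q^n\sum_{k=0}^na_kb_{n-k}$. With $f^c(q)=\sum q^n\bar a_n$ and $f^s=f*f^c$, the regular reciprocal is $f^{-*}=\frac1{f^s}f^c$ (the inverse of $f$ for $*$, where $f^s\neq0$). The slice Hardy space $H^2(\mathbb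 B)$ consists of the slice regular functions $f$ on $\mathbb B$ with $\sup_{0\le r<1}\frac1{2\pi}\int_0^{2\pi}|f(re^{It})|^2dt<\infty$ for some (equivalently, every) $I\in\mathbb S$. Such $f$ is identified with its radial limit on $\partial\mathbb B$, and $H^2(\mathbb B)$ is a right quaternionic Hilbert space (right $\mathbb H$-linear in the first variable) with $$\langle f,g\rangle=\frac1{4\pi^2}\int_{\partial\mathbb B}\frac{1}{|\mathrm{Im}(q)|^2}\,\overline{g(q)}f(q)\,d\sigma(q),\qquad \|f\|^2=\langle f,f\rangle,$$ $d\sigma$ being the surface measure on $\partial\mathbb B$. For $a\in\mathbb B$, the slice normalized Szegő kernel is $e_a(q)=\sqrt{1-|a|^2}\,(1-q\bar a)^{-*}$, and the slice Blaschke factor is $B_a(q)=(1-q\bar a)^{-*}*\big((a-q)\tfrac{a}{|a|}\big)$, where $a/|a|$ is read as $1$ if $a=0$. Put $B^{(0)}=1$ and $B^{(n)}=B_{a_1}*B_{a_2}*\cdots*B_{a_n}$. *)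

theory Defs
  imports "HOL-Analysis.Analysis"
begin

section \<open>Quaternions\<close>

codatatype quat = Quat (Req: real) (Im1: real) (Im2: real) (Im3: real)

lemma quat_eqI [intro?]:
  "Req x = Req y \<Longrightarrow> Im1 x = Im1 y \<Longrightarrow> Im2 x = Im2 y \<Longrightarrow> Im3 x = Im3 y \<Longrightarrow> x = y"
  by (rule quat.expand) simp

lemma quat_eq_iff:
  "x = y \<longleftrightarrow> Req x = Req y \<and> Im1 x = Im1 y \<and> Im2 x = Im2 y \<and> Im3 x = Im3 y"
  by (auto intro: quat.expand)

instantiation quat :: ab_group_add
begin

primcorec zero_quat where
  "Req 0 = 0" | "Im1 0 = 0" | "Im2 0 = 0" | "Im3 0 = 0"

primcorec plus_quat where
  "Req (x + y) = Req x + Req y"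
| "Im1 (x + y) = Im1 x + Im1 y"
| "Im2 (x + y) = Im2 x + Im2 y"
| "Im3 (x + y) = Im3 x + Im3 y"

primcorec uminus_quat where
  "Req (- x) = - Req x" | "Im1 (- x) = - Im1 x" | "Im2 (- x) = - Im2 x" | "Im3 (- x) = - Im3 x"

primcorec minus_quat where
  "Req (x - y) = Req x - Req y"
| "Im1 (x - y) = Im1 x - Im1 y"
| "Im2 (x - y) = Im2 x - Im2 y"
| "Im3 (x - y) = Im3 x - Im3 y"

instance
  by standard (simp_all add: quat_eq_iff)

end

instantiation quat :: real_algebra_1
begin

primcorec one_quat where
  "Req 1 = 1" | "Im1 1 = 0" | "Im2 1 = 0" | "Im3 1 = 0"

primcorec times_quat where
  "Req (x * y) = Req x * Req y - Im1 x * Im1 y - Im2 x * Im2 y - Im3 x * Im3 y"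
| "Im1 (x * y) = Req x * Im1 y + Im1 x * Req y + Im2 x * Im3 y - Im3 x * Im2 y"
| "Im2 (x * y) = Req x * Im2 y - Im1 x * Im3 y + Im2 x * Req y + Im3 x * Im1 y"
| "Im3 (x * y) = Req x * Im3 y + Im1 x * Im2 y - Im2 x * Im1 y + Im3 x * Req y"

primcorec scaleR_quat where
  "Req (scaleR r x) = r * Req x"
| "Im1 (scaleR r x) = r * Im1 x"
| "Im2 (scaleR r x) = r * Im2 x"
| "Im3 (scaleR r x) = r * Im3 x"

instance
  by standard (simp_all add: quat_eq_iff algebra_simps)

end

primcorec cnjq :: "quat \<Rightarrow> quat" where
  "Req (cnjq q) = Req q"
| "Im1 (cnjq q) = - Im1 q"
| "Im2 (cnjq q) = - Im2 q"
| "Im3 (cnjq q) = - Im3 q"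

instantiation quat :: real_div_algebra
begin

definition "inverse x = cnjq x /\<^sub>R ((Req x)\<^sup>2 + (Im1 x)\<^sup>2 + (Im2 x)\<^sup>2 + (Im3 x)\<^sup>2)" for x :: quat

definition "x div y = x * inverse y" for x y :: quat

instance
proof
  fix x y :: quat
  let ?N = "(Req x)\<^sup>2 + (Im1 x)\<^sup>2 + (Im2 x)\<^sup>2 + (Im3 x)\<^sup>2"
  show "x div y = x * inverse y" by (simp add: divide_quat_def)
  show "inverse 0 = (0::quat)" by (simp add: inverse_quat_def quat_eq_iff)
  assume "x \<noteq> 0"
  then have "?N \<noteq> 0"
    by (auto simp: quat_eq_iff add_nonneg_eq_0_iff)
  moreover have "cnjq x * x = ?N *\<^sub>R 1" "x * cnjq x = ?N *\<^sub>R 1"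
    by (simp_all add: quat_eq_iff power2_eq_square)
  ultimately show "inverse x * x = 1" "x * inverse x = 1"
    by (simp_all add: inverse_quat_def)
qed

end

instantiation quat :: real_normed_div_algebra
begin

definition norm_quat_def:
  "norm x = sqrt ((Req x)\<^sup>2 + (Im1 x)\<^sup>2 + (Im2 x)\<^sup>2 + (Im3 x)\<^sup>2)"

definition sgn_quat_def: "sgn (x::quat) = x /\<^sub>R norm x"

definition dist_quat_def: "dist x y = norm (x - y :: quat)"

definition uniformity_quat_def [code del]:
  "(uniformity :: (quat \<times> quat) filter) = (INF e\<in>{0 <..}. principal {(x, y). dist x y < e})"

definition open_quat_def [code del]:
  "open (U :: quat set) \<longleftrightarrow> (\<forall>x\<in>U. eventually (\<lambda>(x', y). x' = x \<longrightarrow> y \<in> U) uniformity)"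

instance
proof
  fix r :: real and x y :: quat and S :: "quat set"
  show "(norm x = 0) = (x = 0)"
    by (simp add: norm_quat_def quat_eq_iff add_nonneg_eq_0_iff)
  have tuple: "norm z = norm (Req z, Im1 z, Im2 z, Im3 z)" for z :: quat
    by (simp add: norm_quat_def norm_Pair add.assoc)
  show "norm (x + y) \<le> norm x + norm y"
    using norm_triangle_ineq [of "(Req x, Im1 x, Im2 x, Im3 x)" "(Req y, Im1 y, Im2 y, Im3 y)"]
    by (simp add: tuple)
  show "norm (scaleR r x) = \<bar>r\<bar> * norm x"
    by (simp add: norm_quat_def power_mult_distrib distrib_left [symmetric] real_sqrt_mult)
  show "norm (x * y) = norm x * norm y"
    unfolding norm_quat_def real_sqrt_mult [symmetric] times_quat.simps
    by (rule arg_cong [where f = sqrt]) algebra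
qed (rule sgn_quat_def dist_quat_def open_quat_def uniformity_quat_def)+

end

instantiation quat :: real_inner
begin

definition inner_quat_def:
  "inner x y = Req x * Req y + Im1 x * Im1 y + Im2 x * Im2 y + Im3 x * Im3 y"

instance
proof
  fix x y z :: quat and r :: real
  show "inner x y = inner y x" "inner (x + y) z = inner x z + inner y z"
    "inner (scaleR r x) y = r * inner x y" "0 \<le> inner x x"
    by (simp_all add: inner_quat_def algebra_simps)
  show "inner x x = 0 \<longleftrightarrow> x = 0"
    by (simp add: inner_quat_def quat_eq_iff add_nonneg_eq_0_iff)
  show "norm x = sqrt (inner x x)"
    by (simp add: inner_quat_def norm_quat_def power2_eq_square)
qed

end

instantiation quat :: euclidean_space
begin

definition Basis_quat_def: "Basis = {Quat 1 0 0 0, Quat 0 1 0 0, Quat 0 0 1 0, Quat 0 0 0 1}"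

instance
proof
  fix u v x :: quat
  show "(Basis :: quat set) \<noteq> {}" "finite (Basis :: quat set)"
    by (simp_all add: Basis_quat_def)
  show "u \<in> Basis \<Longrightarrow> v \<in> Basis \<Longrightarrow> inner u v = (if u = v then 1 else 0)"
    unfolding Basis_quat_def by (elim insertE emptyE; simp add: inner_quat_def)
  show "(\<forall>u\<in>Basis. inner x u = 0) \<longleftrightarrow> x = 0"
    by (simp add: Basis_quat_def inner_quat_def quat_eq_iff [of x 0])
qed

end

lemma DIM_quat [simp]: "DIM(quat) = 4"
  by (simp add: Basis_quat_def)

definition Imq :: "quat \<Rightarrow> quat"
  where "Imq q = q - of_real (Req q)"

definition imag_units :: "quat set"  ("\<S>")
  where "\<S> = {I. I\<^sup>2 = - 1}"

abbreviation unit_ball :: "quat set"  ("\<B>")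
  where "\<B> \<equiv> ball 0 1"


section \<open>Slice regular functions on the unit ball\<close>

text \<open>Functions on the ball are total functions on \<^typ>\<open>quat\<close>; every notion below only depends
  on their values in \<^term>\<open>\<B>\<close>.\<close>

definition slice_point :: "quat \<Rightarrow> real \<Rightarrow> real \<Rightarrow> quat"
  where "slice_point I x y = of_real x + of_real y * I"

definition slice_function :: "(quat \<Rightarrow> quat) \<Rightarrow> bool"
  where "slice_function f \<longleftrightarrow>
    (\<forall>x y. \<forall>I\<in>\<S>. \<forall>J\<in>\<S>.
      slice_point J x y \<in> \<B> \<longrightarrow> slice_point I x y \<in> \<B> \<longrightarrow> slice_point I x (- y) \<in> \<B> \<longrightarrow>
      f (slice_point J x y) =
        (1/2) *\<^sub>R (f (slice_point I x y) + f (slice_point I x (- y))) +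
        (1/2) *\<^sub>R (J * I * (f (slice_point I x (- y)) - f (slice_point I x y))))"

definition slice_regular :: "(quat \<Rightarrow> quat) \<Rightarrow> bool"
  where "slice_regular f \<longleftrightarrow> slice_function f \<and>
    (\<forall>I\<in>\<S>. \<exists>fx fy :: real \<times> real \<Rightarrow> quat.
      continuous_on {(x, y). slice_point I x y \<in> \<B>} fx \<and>
      continuous_on {(x, y). slice_point I x y \<in> \<B>} fy \<and>
      (\<forall>x y. slice_point I x y \<in> \<B> \<longrightarrow>
        ((\<lambda>s. f (slice_point I s y)) has_vector_derivative fx (x, y)) (at x) \<and>
        ((\<lambda>t. f (slice_point I x t)) has_vector_derivative fy (x, y)) (at y) \<and>
        (1/2) *\<^sub>R (fx (x, y) + I * fy (x, y)) = 0))"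

text \<open>The coefficients, placed on the right of the powers, of the power series expansion of \<open>f\<close>
  on the ball. They are unique if they exist, since the values on the real diameter determine
  them; they exist for slice regular \<open>f\<close>.\<close>

definition slice_coeff :: "(quat \<Rightarrow> quat) \<Rightarrow> nat \<Rightarrow> quat"
  where "slice_coeff f = (THE a. \<forall>q\<in>\<B>. (\<lambda>n. q ^ n * a n) sums f q)"

definition star_prod :: "(quat \<Rightarrow> quat) \<Rightarrow> (quat \<Rightarrow> quat) \<Rightarrow> quat \<Rightarrow> quat"  (infixl "\<star>" 70)
  where "(f \<star> g) q = (\<Sum>n. q ^ n * (\<Sum>k\<le>n. slice_coeff f k * slice_coeff g (n - k)))"

definition regular_conj :: "(quat \<Rightarrow> quat) \<Rightarrow> quat \<Rightarrow> quat"
  where "regular_conj f q = (\<Sum>n. q ^ n * cnjq (slice_coeff f n))"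

definition symmetrization :: "(quat \<Rightarrow> quat) \<Rightarrow> quat \<Rightarrow> quat"
  where "symmetrization f = f \<star> regular_conj f"

definition regular_reciprocal :: "(quat \<Rightarrow> quat) \<Rightarrow> quat \<Rightarrow> quat"
  where "regular_reciprocal f q = inverse (symmetrization f q) * regular_conj f q"


section \<open>The slice Hardy space\<close>

text \<open>The surface measure of the unit sphere, as the cone measure: by \<open>dx = r ^ (n - 1) dr d\<sigma>\<close>, the
  set of all \<open>r x\<close> with \<open>x \<in> A\<close> and \<open>0 < r < 1\<close> has Lebesgue measure \<open>\<sigma>(A) / n\<close>, where \<open>n\<close> is the
  dimension of the space. The function \<^const>\<open>sgn\<close> is the radial projection \<open>x / norm x\<close>.\<close>

definition sphere_measure :: "'a::euclidean_space measure"
  where "sphere_measure =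
    scale_measure (of_nat DIM('a))
      (distr (restrict_space lborel (ball 0 1 - {0})) (restrict_space borel (sphere 0 1)) sgn)"

definition radial_limit :: "(quat \<Rightarrow> quat) \<Rightarrow> quat \<Rightarrow> quat"
  where "radial_limit f q = Lim (at_left 1) (\<lambda>r. f (r *\<^sub>R q))"

definition slice_hardy :: "(quat \<Rightarrow> quat) set"
  where "slice_hardy = {f. slice_regular f \<and>
    (\<exists>I\<in>\<S>. bdd_above
      ((\<lambda>r. 1 / (2 * pi) * integral {0..2 * pi} (\<lambda>t. (norm (f (r *\<^sub>R exp (t *\<^sub>R I))))\<^sup>2)) ` {0..<1}))}"

definition hardy_inner :: "(quat \<Rightarrow> quat) \<Rightarrow> (quat \<Rightarrow> quat) \<Rightarrow> quat"
  where "hardy_inner f g = (1 / (4 * pi\<^sup>2)) *\<^sub>R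
    (LINT q|sphere_measure.
      (1 / (norm (Imq q))\<^sup>2) *\<^sub>R (cnjq (radial_limit g q) * radial_limit f q))"


section \<open>The slice Takenaka-Malmquist system\<close>

definition szego_kernel :: "quat \<Rightarrow> quat \<Rightarrow> quat"
  where "szego_kernel a q = sqrt (1 - (norm a)\<^sup>2) *\<^sub>R regular_reciprocal (\<lambda>p. 1 - p * cnjq a) q"

definition blaschke_factor :: "quat \<Rightarrow> quat \<Rightarrow> quat"
  where "blaschke_factor a =
    regular_reciprocal (\<lambda>p. 1 - p * cnjq a) \<star>
      (\<lambda>p. (a - p) * (if a = 0 then 1 else a /\<^sub>R norm a))"

text \<open>The sequence is indexed from 1: \<open>a 0\<close> is never used.\<close>

primrec blaschke_product :: "(nat \<Rightarrow> quat) \<Rightarrow> nat \<Rightarrow> quat \<Rightarrow> quat"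
  where
    "blaschke_product a 0 = (\<lambda>q. 1)"
  | "blaschke_product a (Suc n) = blaschke_product a n \<star> blaschke_factor (a (Suc n))"

definition TM_function :: "(nat \<Rightarrow> quat) \<Rightarrow> nat \<Rightarrow> quat \<Rightarrow> quat"
  where "TM_function a k = blaschke_product a (k - 1) \<star> szego_kernel (a k)"

end

theory Submission
  imports Defs
begin

text \<open>A function on the ball whose power series has absolutely summable coefficients corresponds to a
  formal power series over the quaternions, and the star product corresponds to the product of formal
  power series. The Szego kernel and the Blaschke factor of a point \<open>a\<close> have coefficients of
  size \<open>O(|a| ^ n)\<close>, so every function in the theorem is of this kind. The proof then has an
  analytic and an algebraic half.

  Analytic half: the inner product is the \<open>l\<^sup>2\<close> inner product of the coefficients
  (\<open>hardy_inner_expands\<close>). Writing a unit quaternion as \<open>cos t + I sin t\<close>, surface measure is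
  \<open>sin\<^sup>2 t dt dI\<close>, so the weight \<open>1 / |Im q|\<^sup>2\<close> turns it into \<open>dt dI\<close>, for which the powers
  \<open>q ^ n\<close> are orthogonal. The formal argument works with the cone measure instead of spherical
  coordinates. The volume of balls in three dimensions carries the integral of a function of
  \<open>(Re q, |Im q|)\<close> to an integral over the unit disc of the plane
  (\<open>nn_integral_slice_measure_axis\<close>). There, a rotation by \<open>\<pi> / k\<close> changes the sign of the
  \<open>k\<close>-th moment, which therefore vanishes, and the volume of the four-dimensional ball gives the
  total mass. Absolute summability allows the exchange of sum and integral, and it makes the series
  continuous up to the sphere, where it equals the radial limit.

  Algebraic half: let \<open>u\<close> be the unit \<open>a / |a|\<close>, let \<open>G = B\<^sub>a * F\<close>, with coefficients \<open>f\<^sub>n\<close>, \<open>g\<^sub>n\<close>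
  of \<open>F\<close>, \<open>G\<close>, and let \<open>a'\<close> be the conjugate of \<open>a\<close>. From \<open>(1 - q a') * G = (a - q) * u F\<close>, the
  defect \<open>d\<^sub>n = g\<^sub>n - a u f\<^sub>n\<close> satisfies \<open>d\<^sub>0 = 0\<close> and \<open>d\<^sub>n\<^sub>+\<^sub>1 = a' g\<^sub>n - u f\<^sub>n\<close>. Hence
  \<open>|d\<^sub>n\<^sub>+\<^sub>1|\<^sup>2 - |d\<^sub>n|\<^sup>2 = (1 - |a|\<^sup>2) (|f\<^sub>n|\<^sup>2 - |g\<^sub>n|\<^sup>2)\<close>, and summing over \<open>n\<close> shows that left
  multiplication by \<open>B\<^sub>a\<close> is isometric (\<open>fps_inner_blaschke_mult\<close>). In the same way
  \<open>a ^ (n + 1) d\<^sub>n\<^sub>+\<^sub>1 - a ^ n d\<^sub>n = (|a|\<^sup>2 - 1) a ^ n g\<^sub>n\<close> sums to zero, which says that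
  \<open>B\<^sub>a * F\<close> is orthogonal to the Szego kernel of \<open>a\<close> (\<open>fps_inner_blaschke_szego\<close>). For \<open>k < l\<close>,
  the common left factor \<open>B\<^sup>(\<^sup>k\<^sup>-\<^sup>1\<^sup>)\<close> cancels from the inner product of \<open>T\<^sub>l\<close> and \<open>T\<^sub>k\<close>, and what
  remains is of the form \<open>\<langle>B\<^sub>a * F, e\<^sub>a\<rangle> = 0\<close> with \<open>a = a\<^sub>k\<close>; for \<open>k = l\<close> what remains is the
  geometric series \<open>\<langle>e\<^sub>a, e\<^sub>a\<rangle> = 1\<close>.\<close>

section \<open>Rotations of the plane and the distribution of the norm in three dimensions\<close>

text \<open>By Fubini, a shear only translates each one-dimensional fibre.\<close>

lemma distr_shear_lborel:
  fixes s :: real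
  shows "distr lborel borel (\<lambda>p. (fst p + s * snd p, snd p)) = (lborel :: (real \<times> real) measure)"
    and "distr lborel borel (\<lambda>p. (fst p, snd p + s * fst p)) = (lborel :: (real \<times> real) measure)"
proof -
  have shift: "(\<integral>\<^sup>+x. h (x + t) \<partial>lborel) = (\<integral>\<^sup>+x. h x \<partial>lborel)"
    if "h \<in> borel_measurable borel" for h :: "real \<Rightarrow> ennreal" and t
    using nn_integral_real_affine[OF that, of 1 t] by (simp add: add.commute)
  have meas [measurable]: "(\<lambda>p::real \<times> real. (fst p + s * snd p, snd p)) \<in> borel \<rightarrow>\<^sub>M borel"
    "(\<lambda>p::real \<times> real. (fst p, snd p + s * fst p)) \<in> borel \<rightarrow>\<^sub>M borel"
    by (intro borel_measurable_continuous_onI continuous_intros)+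
  have curry [measurable]: "(\<lambda>x. h (x, y)) \<in> borel_measurable borel" "(\<lambda>x. h (y, x)) \<in> borel_measurable borel"
    if "h \<in> borel_measurable borel" for h :: "real \<times> real \<Rightarrow> ennreal" and y
    by (rule measurable_compose[OF _ that], intro borel_measurable_continuous_onI continuous_intros)+
  have prod: "h \<in> borel_measurable (lborel \<Otimes>\<^sub>M lborel)"
    if "h \<in> borel_measurable borel" for h :: "real \<times> real \<Rightarrow> ennreal"
    using that by (simp add: lborel_prod)
  show "distr lborel borel (\<lambda>p. (fst p + s * snd p, snd p)) = (lborel :: (real \<times> real) measure)"
  proof (rule measure_eqI)
    fix A :: "(real \<times> real) set" assume "A \<in> sets (distr lborel borel (\<lambda>p. (fst p + s * snd p, snd p)))"
    then have A [measurable]: "A \<in> sets borel" by simp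
    have "emeasure (distr lborel borel (\<lambda>p. (fst p + s * snd p, snd p))) A =
        (\<integral>\<^sup>+p. indicator A (fst p + s * snd p, snd p) \<partial>(lborel \<Otimes>\<^sub>M lborel))"
      by (simp add: nn_integral_indicator[symmetric] nn_integral_distr lborel_prod del: nn_integral_indicator)
    also have "\<dots> = (\<integral>\<^sup>+y. \<integral>\<^sup>+x. indicator A (x + s * y, y) \<partial>lborel \<partial>lborel)"
      by (subst lborel_pair.nn_integral_snd[symmetric]) (auto intro!: prod)
    also have "\<dots> = (\<integral>\<^sup>+y. \<integral>\<^sup>+x. indicator A (x, y) \<partial>lborel \<partial>lborel)"
      by (intro nn_integral_cong shift) simp
    also have "\<dots> = (\<integral>\<^sup>+p. indicator A p \<partial>(lborel \<Otimes>\<^sub>M lborel))"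
      by (subst lborel_pair.nn_integral_snd[symmetric]) (auto intro!: prod)
    finally show "emeasure (distr lborel borel (\<lambda>p. (fst p + s * snd p, snd p))) A = emeasure lborel A"
      by (simp add: lborel_prod)
  qed simp
  show "distr lborel borel (\<lambda>p. (fst p, snd p + s * fst p)) = (lborel :: (real \<times> real) measure)"
  proof (rule measure_eqI)
    fix A :: "(real \<times> real) set" assume "A \<in> sets (distr lborel borel (\<lambda>p. (fst p, snd p + s * fst p)))"
    then have A [measurable]: "A \<in> sets borel" by simp
    have "emeasure (distr lborel borel (\<lambda>p. (fst p, snd p + s * fst p))) A =
        (\<integral>\<^sup>+p. indicator A (fst p, snd p + s * fst p) \<partial>(lborel \<Otimes>\<^sub>M lborel))"
      by (simp add: nn_integral_indicator[symmetric] nn_integral_distr lborel_prod del: nn_integral_indicator)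
    also have "\<dots> = (\<integral>\<^sup>+x. \<integral>\<^sup>+y. indicator A (x, y + s * x) \<partial>lborel \<partial>lborel)"
      by (subst lborel.nn_integral_fst[symmetric]) (auto intro!: prod)
    also have "\<dots> = (\<integral>\<^sup>+x. \<integral>\<^sup>+y. indicator A (x, y) \<partial>lborel \<partial>lborel)"
      by (intro nn_integral_cong shift) simp
    also have "\<dots> = (\<integral>\<^sup>+p. indicator A p \<partial>(lborel \<Otimes>\<^sub>M lborel))"
      by (subst lborel.nn_integral_fst[symmetric]) (auto intro!: prod)
    finally show "emeasure (distr lborel borel (\<lambda>p. (fst p, snd p + s * fst p))) A = emeasure lborel A"
      by (simp add: lborel_prod)
  qed simp
qed

definition rotation :: "real \<Rightarrow> real \<times> real \<Rightarrow> real \<times> real"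
  where "rotation \<theta> p = (cos \<theta> * fst p - sin \<theta> * snd p, sin \<theta> * fst p + cos \<theta> * snd p)"

lemma rotation_measurable [measurable]: "rotation \<theta> \<in> borel \<rightarrow>\<^sub>M borel"
  unfolding rotation_def by (intro borel_measurable_continuous_onI continuous_intros)

text \<open>A rotation by an angle other than \<open>\<pi>\<close> is a product of three shears, with the shear factors
  \<open>- tan (\<theta> / 2)\<close>, \<open>sin \<theta>\<close>, \<open>- tan (\<theta> / 2)\<close>.\<close>

lemma distr_rotation_lborel:
  assumes "cos (\<theta> / 2) \<noteq> 0"
  shows "distr lborel borel (rotation \<theta>) = (lborel :: (real \<times> real) measure)"
proof -
  define X Y :: "real \<Rightarrow> real \<times> real \<Rightarrow> real \<times> real"
    where "X s p = (fst p + s * snd p, snd p)" and "Y s p = (fst p, snd p + s * fst p)" for s p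
  have [measurable]: "X s \<in> borel \<rightarrow>\<^sub>M borel" "Y s \<in> borel \<rightarrow>\<^sub>M borel" for s
    unfolding X_def Y_def by (intro borel_measurable_continuous_onI continuous_intros)+
  have XY: "distr lborel borel (X s) = lborel" "distr lborel borel (Y s) = lborel" for s
    unfolding X_def Y_def by (rule distr_shear_lborel)+
  \<comment> \<open>Half-angle formulas: the tangent of half the angle is \<open>(1 - cos \<theta>) / sin \<theta> = sin \<theta> / (1 + cos \<theta>)\<close>.\<close>
  define t where "t = tan (\<theta> / 2)"
  have s: "sin \<theta> = 2 * sin (\<theta> / 2) * cos (\<theta> / 2)" "cos \<theta> = 1 - 2 * (sin (\<theta> / 2))\<^sup>2"
    using sin_double[of "\<theta> / 2"] cos_double_sin[of "\<theta> / 2"] by simp_all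
  have ts: "t * sin \<theta> = 1 - cos \<theta>"
    using assms by (simp add: s t_def tan_def power2_eq_square)
  have "1 + cos \<theta> = 2 * (cos (\<theta> / 2))\<^sup>2"
    by (simp add: s sin_squared_eq)
  then have tc: "t * (1 + cos \<theta>) = sin \<theta>"
    using assms by (simp add: s t_def tan_def power2_eq_square)
  have "rotation \<theta> = X (- t) \<circ> (Y (sin \<theta>) \<circ> X (- t))"
  proof
    fix p :: "real \<times> real"
    have "fst p - t * snd p - t * (snd p + sin \<theta> * (fst p - t * snd p))
        = (1 - t * sin \<theta>) * fst p + (t * (t * sin \<theta>) - 2 * t) * snd p" by algebra
    also have "\<dots> = cos \<theta> * fst p - sin \<theta> * snd p"
    proof -
      have "1 - t * sin \<theta> = cos \<theta>" using ts by simp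
      moreover have "t * (t * sin \<theta>) - 2 * t = - sin \<theta>" using ts tc by algebra
      ultimately show ?thesis by simp
    qed
    finally have 1: "fst p - t * snd p - t * (snd p + sin \<theta> * (fst p - t * snd p)) = cos \<theta> * fst p - sin \<theta> * snd p" .
    have "snd p + sin \<theta> * (fst p - t * snd p) = sin \<theta> * fst p + (1 - t * sin \<theta>) * snd p" by algebra
    then have 2: "snd p + sin \<theta> * (fst p - t * snd p) = sin \<theta> * fst p + cos \<theta> * snd p" by (simp add: ts)
    from 1 2 show "rotation \<theta> p = (X (- t) \<circ> (Y (sin \<theta>) \<circ> X (- t))) p"
      by (simp add: rotation_def X_def Y_def)
  qed
  then have "distr lborel borel (rotation \<theta>) =
      distr (distr (distr lborel borel (X (- t))) borel (Y (sin \<theta>))) borel (X (- t))"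
    by (simp add: distr_distr o_assoc)
  then show ?thesis by (simp add: XY)
qed

text \<open>The volume of a ball of radius \<open>r\<close> in three dimensions is \<open>4/3 \<pi> r\<^sup>3\<close>, the integral of
  \<open>2 \<pi> y\<^sup>2\<close> over \<open>[- r, r]\<close>. The two-sided form, with \<open>\<bar>y\<bar>\<close> in place of a positive radius,
  leads to the full disc, which is invariant under rotations, instead of a half disc.\<close>

lemma distr_norm_lborel_3:
  "distr (lborel :: (real \<times> real \<times> real) measure) borel norm
    = distr (density lborel (\<lambda>y. ennreal (2 * pi * y\<^sup>2))) borel abs"
proof -
  have ball: "emeasure (distr (lborel :: (real \<times> real \<times> real) measure) borel norm) {..r}
      = emeasure (distr (density lborel (\<lambda>y. ennreal (2 * pi * y\<^sup>2))) borel abs) {..r}" for r :: real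
  proof (cases "0 \<le> r")
    case True
    have "emeasure (distr (lborel :: (real \<times> real \<times> real) measure) borel norm) {..r}
        = emeasure lborel (cball (0 :: real \<times> real \<times> real) r)"
      by (subst emeasure_distr) (auto intro!: arg_cong[where f = "emeasure lborel"])
    also have "\<dots> = ennreal (4 / 3 * pi * r ^ 3)"
      using True by (subst emeasure_cball) (simp_all add: unit_ball_vol_3 power3_eq_cube)
    also have "\<dots> = ennreal (2 / 3 * pi * r ^ 3 - 2 / 3 * pi * (- r) ^ 3)"
      by (rule arg_cong[where f = ennreal]) algebra
    also have "\<dots> = (\<integral>\<^sup>+y. ennreal (2 * pi * y\<^sup>2) * indicator {- r..r} y \<partial>lborel)"
      using True by (intro nn_integral_FTC_Icc[symmetric]) (auto intro!: derivative_eq_intros)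
    also have "\<dots> = emeasure (density lborel (\<lambda>y. ennreal (2 * pi * y\<^sup>2))) {- r..r}"
      by (subst emeasure_density) auto
    also have "\<dots> = emeasure (distr (density lborel (\<lambda>y. ennreal (2 * pi * y\<^sup>2))) borel abs) {..r}"
      by (subst emeasure_distr) (auto intro!: arg_cong2[where f = emeasure])
    finally show ?thesis .
  next
    case False
    then have "norm -` {..r} = ({} :: (real \<times> real \<times> real) set)" "abs -` {..r} = {}"
      by (auto simp: not_le intro: order.strict_trans2[OF _ norm_ge_zero] dest: order.trans[OF norm_ge_zero])
    then show ?thesis by (simp add: emeasure_distr)
  qed
  show ?thesis
  proof (rule measure_eqI_generator_eq[where E = "range atMost" and \<Omega> = UNIV and A = "\<lambda>n. {..real n}"])
    show "Int_stable (range atMost :: real set set)"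
      by (auto simp: Int_stable_def)
    show "(\<Union>n. {..real n}) = UNIV"
      using real_arch_simple by auto
    fix n :: nat
    have "emeasure (distr (lborel :: (real \<times> real \<times> real) measure) borel norm) {..real n}
        = emeasure lborel (cball (0 :: real \<times> real \<times> real) n)"
      by (subst emeasure_distr) (auto intro!: arg_cong[where f = "emeasure lborel"])
    then show "emeasure (distr (lborel :: (real \<times> real \<times> real) measure) borel norm) {..real n} \<noteq> \<infinity>"
      using emeasure_lborel_cball_finite[of "0 :: real \<times> real \<times> real" "real n"] by simp
  qed (use ball in \<open>auto simp: borel_eq_atMost sets_measure_of\<close>)
qed

section \<open>Quaternionic coordinates and the cone measure on the sphere\<close>

lemma quat_coord_inner:
  "Req q = q \<bullet> Quat 1 0 0 0" "Im1 q = q \<bullet> Quat 0 1 0 0"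
  "Im2 q = q \<bullet> Quat 0 0 1 0" "Im3 q = q \<bullet> Quat 0 0 0 1"
  by (simp_all add: inner_quat_def)

lemma bounded_linear_Req: "bounded_linear Req"
  unfolding quat_coord_inner(1)[abs_def] by (rule bounded_linear_inner_left)

lemma norm_cnjq [simp]: "norm (cnjq q) = norm q"
  by (simp add: norm_quat_def)

lemma bounded_linear_cnjq: "bounded_linear cnjq"
  by (rule bounded_linear_intro[where K = 1]) (simp_all add: quat_eq_iff)

lemma cnjq_mult [simp]: "cnjq (p * q) = cnjq q * cnjq p"
  by (simp add: quat_eq_iff algebra_simps)

lemma cnjq_cnjq [simp]: "cnjq (cnjq q) = q"
  by (simp add: quat_eq_iff)

lemma cnjq_power: "cnjq (q ^ n) = cnjq q ^ n"
  by (induction n) (simp_all add: quat_eq_iff[of "cnjq 1"] power_commutes)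

lemma Req_of_real [simp]: "Req (of_real x) = x" "Im1 (of_real x) = 0" "Im2 (of_real x) = 0" "Im3 (of_real x) = 0"
  by (simp_all add: of_real_def)

lemma cnjq_mult_self: "cnjq q * q = of_real ((norm q)\<^sup>2)" "q * cnjq q = of_real ((norm q)\<^sup>2)"
  by (simp_all add: quat_eq_iff norm_quat_def power2_eq_square)

lemma continuous_on_quat_coord [continuous_intros]:
  assumes "continuous_on S f"
  shows "continuous_on S (\<lambda>x. Req (f x))" "continuous_on S (\<lambda>x. Im1 (f x))"
    "continuous_on S (\<lambda>x. Im2 (f x))" "continuous_on S (\<lambda>x. Im3 (f x))"
    "continuous_on S (\<lambda>x. cnjq (f x))" "continuous_on S (\<lambda>x. Imq (f x))"
  unfolding quat_coord_inner Imq_def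
  by (intro continuous_intros assms bounded_linear.continuous_on[OF bounded_linear_cnjq])+

lemma measurable_quat_coord [measurable]:
  "Req \<in> borel_measurable borel" "Im1 \<in> borel_measurable borel" "Im2 \<in> borel_measurable borel"
  "Im3 \<in> borel_measurable borel" "cnjq \<in> borel_measurable borel" "Imq \<in> borel_measurable borel"
  by (intro borel_measurable_continuous_onI continuous_intros)+

lemma Imq_simps [simp]: "Req (Imq q) = 0" "Im1 (Imq q) = Im1 q" "Im2 (Imq q) = Im2 q" "Im3 (Imq q) = Im3 q"
  by (simp_all add: Imq_def)

lemma norm_Imq: "norm (Imq q) = norm (Im1 q, Im2 q, Im3 q)"
  by (simp add: norm_quat_def norm_Pair add.assoc)

lemma norm_quat_parts: "norm q = norm (Req q, norm (Imq q))"
  by (simp add: norm_quat_def norm_Pair add.assoc)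

text \<open>Both measures agree on boxes, hence everywhere; this makes Fubini available for \<^typ>\<open>quat\<close>.\<close>

lemma distr_quat_coord_lborel:
  "distr (lborel :: quat measure) borel (\<lambda>q. (Req q, Im1 q, Im2 q, Im3 q)) = lborel"
proof (rule lborel_eqI[symmetric])
  fix l u :: "real \<times> real \<times> real \<times> real"
  have B: "(Basis :: (real \<times> real \<times> real \<times> real) set) = {(1, 0, 0, 0), (0, 1, 0, 0), (0, 0, 1, 0), (0, 0, 0, 1)}"
    by (simp add: Basis_prod_def zero_prod_def insert_commute)
  obtain l0 l1 l2 l3 u0 u1 u2 u3 where lu: "l = (l0, l1, l2, l3)" "u = (u0, u1, u2, u3)"
    by (cases l; cases u) auto
  assume "\<And>b. b \<in> Basis \<Longrightarrow> l \<bullet> b \<le> u \<bullet> b"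
  then have "\<forall>b\<in>Basis. l \<bullet> b \<le> u \<bullet> b" by blast
  then have le: "l0 \<le> u0" "l1 \<le> u1" "l2 \<le> u2" "l3 \<le> u3"
    by (simp_all add: B lu)
  have pre: "(\<lambda>q. (Req q, Im1 q, Im2 q, Im3 q)) -` box l u = box (Quat l0 l1 l2 l3) (Quat u0 u1 u2 u3)"
    by (auto simp: box_def B Basis_quat_def inner_quat_def lu)
  have "emeasure (distr (lborel :: quat measure) borel (\<lambda>q. (Req q, Im1 q, Im2 q, Im3 q))) (box l u)
      = emeasure lborel (box (Quat l0 l1 l2 l3) (Quat u0 u1 u2 u3))"
    by (subst emeasure_distr) (auto simp: pre)
  also have "\<dots> = ennreal (\<Prod>b\<in>Basis. (Quat u0 u1 u2 u3 - Quat l0 l1 l2 l3) \<bullet> b)"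
    using le by (subst emeasure_lborel_box) (auto simp: Basis_quat_def inner_quat_def)
  also have "(\<Prod>b\<in>Basis. (Quat u0 u1 u2 u3 - Quat l0 l1 l2 l3) \<bullet> b) = (\<Prod>b\<in>Basis. (u - l) \<bullet> b)"
    by (simp add: Basis_quat_def inner_quat_def lu B)
  finally show "emeasure (distr (lborel :: quat measure) borel (\<lambda>q. (Req q, Im1 q, Im2 q, Im3 q))) (box l u)
      = ennreal (\<Prod>b\<in>Basis. (u - l) \<bullet> b)" .
qed simp

lemma distr_cnjq_lborel: "distr lborel borel cnjq = lborel"
proof (rule lborel_eqI[symmetric])
  fix l u :: quat
  assume "\<And>b. b \<in> Basis \<Longrightarrow> l \<bullet> b \<le> u \<bullet> b"
  then have "\<forall>b\<in>Basis. l \<bullet> b \<le> u \<bullet> b" by blast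
  then have le: "Req l \<le> Req u" "Im1 l \<le> Im1 u" "Im2 l \<le> Im2 u" "Im3 l \<le> Im3 u"
    by (simp_all add: Basis_quat_def inner_quat_def)
  let ?l = "Quat (Req l) (- Im1 u) (- Im2 u) (- Im3 u)"
  let ?u = "Quat (Req u) (- Im1 l) (- Im2 l) (- Im3 l)"
  have pre: "cnjq -` box l u = box ?l ?u"
    by (rule set_eqI, simp add: box_def Basis_quat_def inner_quat_def minus_less_iff less_minus_iff, blast)
  have "emeasure (distr lborel borel cnjq) (box l u) = emeasure lborel (box ?l ?u)"
    by (subst emeasure_distr) (auto simp: pre)
  also have "\<dots> = ennreal (\<Prod>b\<in>Basis. (?u - ?l) \<bullet> b)"
    using le by (subst emeasure_lborel_box) (auto simp: Basis_quat_def inner_quat_def)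
  also have "(\<Prod>b\<in>Basis. (?u - ?l) \<bullet> b) = (\<Prod>b\<in>Basis. (u - l) \<bullet> b)"
    by (simp add: Basis_quat_def inner_quat_def)
  finally show "emeasure (distr lborel borel cnjq) (box l u) = ennreal (\<Prod>b\<in>Basis. (u - l) \<bullet> b)" .
qed simp

text \<open>Split a quaternion into its real part and its imaginary part in three-dimensional space, and
  replace the norm of the latter by \<open>\<bar>y\<bar>\<close> with density \<open>2 \<pi> y\<^sup>2\<close>.\<close>

lemma nn_integral_lborel_axis:
  assumes [measurable]: "h \<in> borel_measurable borel"
  shows "(\<integral>\<^sup>+q. h (Req q, norm (Imq q)) \<partial>lborel)
    = (\<integral>\<^sup>+p. ennreal (2 * pi * (snd p)\<^sup>2) * h (fst p, \<bar>snd p\<bar>) \<partial>lborel)"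
proof -
  have [measurable]: "(\<lambda>v::real \<times> real \<times> real. h (x, norm v)) \<in> borel_measurable borel"
    "(\<lambda>y. h (x, y)) \<in> borel_measurable borel" "(\<lambda>y. h (x, \<bar>y\<bar>)) \<in> borel_measurable borel" for x
    by (rule measurable_compose[OF _ assms], intro borel_measurable_continuous_onI continuous_intros)+
  have m: "(\<lambda>p::real \<times> real \<times> real \<times> real. h (fst p, norm (snd p))) \<in> borel_measurable borel"
    "(\<lambda>p::real \<times> real. h (fst p, \<bar>snd p\<bar>)) \<in> borel_measurable borel"
    by (rule measurable_compose[OF _ assms], intro borel_measurable_continuous_onI continuous_intros)+
  have "(\<lambda>p::real \<times> real. ennreal (2 * pi * (snd p)\<^sup>2)) \<in> borel_measurable borel"
    by (intro measurable_compose[OF _ measurable_ennreal] borel_measurable_continuous_onI continuous_intros)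
  with m have m': "(\<lambda>p::real \<times> real \<times> real \<times> real. h (fst p, norm (snd p))) \<in> borel_measurable (lborel \<Otimes>\<^sub>M lborel)"
    "(\<lambda>p::real \<times> real. ennreal (2 * pi * (snd p)\<^sup>2) * h (fst p, \<bar>snd p\<bar>)) \<in> borel_measurable (lborel \<Otimes>\<^sub>M lborel)"
    unfolding lborel_prod
    by (simp_all add: borel_measurable_times_ennreal)
  have "(\<integral>\<^sup>+q. h (Req q, norm (Imq q)) \<partial>lborel)
      = (\<integral>\<^sup>+p. h (fst p, norm (snd p)) \<partial>distr (lborel :: quat measure) borel (\<lambda>q. (Req q, Im1 q, Im2 q, Im3 q)))"
    using m(1) by (subst nn_integral_distr) (auto simp: norm_Imq)
  also have "\<dots> = (\<integral>\<^sup>+p. h (fst p, norm (snd p)) \<partial>(lborel \<Otimes>\<^sub>M (lborel :: (real \<times> real \<times> real) measure)))"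
    by (simp add: distr_quat_coord_lborel lborel_prod)
  also have "\<dots> = (\<integral>\<^sup>+x. \<integral>\<^sup>+v. h (x, norm v) \<partial>(lborel :: (real \<times> real \<times> real) measure) \<partial>lborel)"
    by (subst lborel.nn_integral_fst[symmetric, OF m'(1)]) simp
  also have "\<dots> = (\<integral>\<^sup>+x. \<integral>\<^sup>+y. h (x, y) \<partial>distr (lborel :: (real \<times> real \<times> real) measure) borel norm \<partial>lborel)"
    by (subst nn_integral_distr) auto
  also have "\<dots> = (\<integral>\<^sup>+x. \<integral>\<^sup>+y. ennreal (2 * pi * y\<^sup>2) * h (x, \<bar>y\<bar>) \<partial>lborel \<partial>lborel)"
    by (simp add: distr_norm_lborel_3 nn_integral_distr nn_integral_density)
  also have "\<dots> = (\<integral>\<^sup>+p. ennreal (2 * pi * (snd p)\<^sup>2) * h (fst p, \<bar>snd p\<bar>) \<partial>(lborel \<Otimes>\<^sub>M lborel))"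
    by (subst lborel.nn_integral_fst[symmetric, OF m'(2)]) simp
  finally show ?thesis by (simp add: lborel_prod)
qed

text \<open>The measure \<open>dt dI / (4 \<pi>\<^sup>2)\<close> in the coordinates \<open>q = cos t + I sin t\<close> of the sphere, against which
  the Hardy inner product integrates.\<close>

definition slice_measure :: "quat measure"
  where "slice_measure = density sphere_measure (\<lambda>q. ennreal (1 / (4 * pi\<^sup>2 * (norm (Imq q))\<^sup>2)))"

lemma space_sphere_measure [simp]: "space sphere_measure = sphere 0 1"
  and sets_sphere_measure [simp, measurable_cong]: "sets sphere_measure = sets (restrict_space borel (sphere 0 1))"
  by (simp_all add: sphere_measure_def space_scale_measure space_restrict_space)

lemma space_slice_measure [simp]: "space slice_measure = sphere 0 1"
  and sets_slice_measure [simp, measurable_cong]: "sets slice_measure = sets (restrict_space borel (sphere 0 1))"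
  by (simp_all add: slice_measure_def)

lemma measurable_sphere_measure:
  "f \<in> borel_measurable borel \<Longrightarrow> f \<in> borel_measurable sphere_measure"
  "f \<in> borel_measurable borel \<Longrightarrow> f \<in> borel_measurable slice_measure"
  by (simp_all add: measurable_restrict_space1 cong: measurable_cong_sets)

lemma nn_integral_sphere_measure:
  fixes h :: "'a::euclidean_space \<Rightarrow> ennreal"
  assumes [measurable]: "h \<in> borel_measurable borel"
  shows "(\<integral>\<^sup>+q. h q \<partial>sphere_measure)
    = of_nat DIM('a) * (\<integral>\<^sup>+q. h (sgn q) * indicator (ball 0 1 - {0}) q \<partial>lborel)"
proof -
  have sgn: "sgn \<in> restrict_space lborel (ball 0 1 - {0}) \<rightarrow>\<^sub>M restrict_space borel (sphere 0 (1 :: real) :: 'a set)"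
    by (rule measurable_restrict_space3) (auto simp: sgn_div_norm norm_sgn)
  have [measurable]: "h \<in> borel_measurable (restrict_space borel (sphere 0 1))"
    by (rule measurable_restrict_space1) fact
  show ?thesis
    unfolding sphere_measure_def
    by (subst nn_integral_scale_measure) (simp_all add: nn_integral_distr[OF sgn] nn_integral_restrict_space)
qed

lemma Imq_scaleR: "Imq (c *\<^sub>R q) = c *\<^sub>R Imq q"
  by (simp add: quat_eq_iff)

text \<open>The cone measure contributes the factor 4, the dimension, and \<open>1 / |Im (q / |q|)|\<^sup>2\<close> is
  \<open>|q|\<^sup>2 / |Im q|\<^sup>2\<close>.\<close>

lemma nn_integral_slice_measure:
  assumes [measurable]: "h \<in> borel_measurable borel"
  shows "(\<integral>\<^sup>+q. h q \<partial>slice_measure)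
    = (\<integral>\<^sup>+q. ennreal ((norm q)\<^sup>2 / (pi\<^sup>2 * (norm (Imq q))\<^sup>2)) * h (sgn q) * indicator (ball 0 1 - {0}) q \<partial>lborel)"
proof -
  have "(\<integral>\<^sup>+q. h q \<partial>slice_measure)
      = (\<integral>\<^sup>+q. ennreal (1 / (4 * pi\<^sup>2 * (norm (Imq q))\<^sup>2)) * h q \<partial>sphere_measure)"
    unfolding slice_measure_def
    by (subst nn_integral_density) (auto intro!: measurable_sphere_measure)
  also have "\<dots> = (\<integral>\<^sup>+q. 4 * (ennreal (1 / (4 * pi\<^sup>2 * (norm (Imq (sgn q)))\<^sup>2)) * h (sgn q)
      * indicator (ball 0 1 - {0}) q) \<partial>lborel)"
    by (subst nn_integral_sphere_measure, measurable, subst nn_integral_cmult)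
      (auto intro!: borel_measurable_times_ennreal borel_measurable_indicator)
  also have "\<dots> = (\<integral>\<^sup>+q. ennreal ((norm q)\<^sup>2 / (pi\<^sup>2 * (norm (Imq q))\<^sup>2)) * h (sgn q)
      * indicator (ball 0 1 - {0}) q \<partial>lborel)"
  proof (intro nn_integral_cong)
    fix q :: quat
    have "4 * ennreal (1 / (4 * pi\<^sup>2 * (norm (Imq (sgn q)))\<^sup>2)) = ennreal (4 * (1 / (4 * pi\<^sup>2 * (norm (Imq (sgn q)))\<^sup>2)))"
      by (subst ennreal_mult) auto
    also have "4 * (1 / (4 * pi\<^sup>2 * (norm (Imq (sgn q)))\<^sup>2)) = (norm q)\<^sup>2 / (pi\<^sup>2 * (norm (Imq q))\<^sup>2)"
      by (simp add: sgn_div_norm Imq_scaleR power_mult_distrib power_inverse field_simps)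
    finally show "4 * (ennreal (1 / (4 * pi\<^sup>2 * (norm (Imq (sgn q)))\<^sup>2)) * h (sgn q) * indicator (ball 0 1 - {0}) q)
      = ennreal ((norm q)\<^sup>2 / (pi\<^sup>2 * (norm (Imq q))\<^sup>2)) * h (sgn q) * indicator (ball 0 1 - {0}) q"
      by (simp add: mult.assoc[symmetric])
  qed
  finally show ?thesis .
qed

section \<open>Reduction of zonal integrals to the unit disc\<close>

text \<open>The weight \<open>1 / y\<^sup>2\<close> has the value 0 on the line \<open>y = 0\<close> by convention, so cancelling it against
  \<open>y\<^sup>2\<close> is valid almost everywhere only.\<close>

lemma AE_snd_nonzero: "AE p in (lborel :: (real \<times> real) measure). snd p \<noteq> 0"
proof -
  have "negligible {p :: real \<times> real. (0, 1) \<bullet> p = 0}"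
    by (rule negligible_hyperplane) (simp add: prod_eq_iff)
  moreover have "{p :: real \<times> real. (0, 1) \<bullet> p = 0} = {p. snd p = 0}"
    by (auto simp: inner_prod_def)
  moreover have "{p :: real \<times> real. snd p = 0} \<in> sets borel"
    by (intro borel_closed closed_Collect_eq continuous_intros)
  ultimately have "{p :: real \<times> real. snd p = 0} \<in> null_sets lborel"
    by (simp add: null_sets_completion_iff negligible_iff_null_sets)
  from AE_not_in[OF this] show ?thesis by simp
qed

lemma measurable_axis [measurable]:
  "(\<lambda>q. (Req q, norm (Imq q))) \<in> borel \<rightarrow>\<^sub>M borel"
  "(\<lambda>p::real \<times> real. (fst p, \<bar>snd p\<bar>)) \<in> borel \<rightarrow>\<^sub>M borel"
  "(\<lambda>p::real \<times> real. (fst (sgn p), \<bar>snd (sgn p)\<bar>)) \<in> borel \<rightarrow>\<^sub>M borel"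
proof -
  show abs: "(\<lambda>p::real \<times> real. (fst p, \<bar>snd p\<bar>)) \<in> borel \<rightarrow>\<^sub>M borel"
    by (intro borel_measurable_continuous_onI continuous_intros)
  show "(\<lambda>p::real \<times> real. (fst (sgn p), \<bar>snd (sgn p)\<bar>)) \<in> borel \<rightarrow>\<^sub>M borel"
    by (rule measurable_compose[OF _ abs]) measurable
  show "(\<lambda>q. (Req q, norm (Imq q))) \<in> borel \<rightarrow>\<^sub>M borel"
    by (intro borel_measurable_continuous_onI continuous_intros)
qed

text \<open>The density \<open>2 \<pi> y\<^sup>2\<close> of the norm of the imaginary part cancels the singular weight
  \<open>|p|\<^sup>2 / (\<pi>\<^sup>2 y\<^sup>2)\<close>, and the weight \<open>2 |p|\<^sup>2 / \<pi>\<close> that remains is radial, hence invariant under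
  rotations.\<close>

lemma nn_integral_slice_measure_axis:
  assumes [measurable]: "h \<in> borel_measurable borel"
  shows "(\<integral>\<^sup>+q. h (Req q, norm (Imq q)) \<partial>slice_measure)
    = (\<integral>\<^sup>+p. ennreal (2 / pi * (norm p)\<^sup>2 * indicator (ball 0 1) p) * h (fst (sgn p), \<bar>snd (sgn p)\<bar>) \<partial>lborel)"
proof -
  define k where "k p = ennreal ((norm p)\<^sup>2 / (pi\<^sup>2 * (snd p)\<^sup>2)) * h (sgn p) * indicator (ball 0 1 - {0}) p"
    for p :: "real \<times> real"
  have w: "(\<lambda>p::real \<times> real. ennreal ((norm p)\<^sup>2 / (pi\<^sup>2 * (snd p)\<^sup>2))) \<in> borel_measurable borel"
    by (intro measurable_compose[OF _ measurable_ennreal] borel_measurable_divide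
        borel_measurable_continuous_onI continuous_intros)
  have hs: "(\<lambda>p. h (sgn p)) \<in> borel_measurable borel" by measurable
  have [measurable]: "k \<in> borel_measurable borel"
    unfolding k_def by (intro borel_measurable_times_ennreal borel_measurable_indicator w hs) simp
  have "(\<integral>\<^sup>+q. h (Req q, norm (Imq q)) \<partial>slice_measure) = (\<integral>\<^sup>+q. k (Req q, norm (Imq q)) \<partial>lborel)"
  proof (subst nn_integral_slice_measure, measurable, intro nn_integral_cong)
    fix q :: quat
    have "(q \<in> ball 0 1 - {0}) = ((Req q, norm (Imq q)) \<in> ball 0 1 - {0})"
      using norm_quat_parts[of q] norm_eq_zero[of q] norm_eq_zero[of "(Req q, norm (Imq q))"] by simp
    then have ind: "indicator (ball 0 1 - {0}) q = (indicator (ball 0 1 - {0}) (Req q, norm (Imq q)) :: ennreal)"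
      by (simp add: indicator_def)
    have "(Req (sgn q), norm (Imq (sgn q))) = sgn (Req q, norm (Imq q))"
      by (simp add: sgn_div_norm Imq_scaleR norm_quat_parts[symmetric])
    then show "ennreal ((norm q)\<^sup>2 / (pi\<^sup>2 * (norm (Imq q))\<^sup>2)) * h (Req (sgn q), norm (Imq (sgn q))) *
        indicator (ball 0 1 - {0}) q = k (Req q, norm (Imq q))"
      by (simp only: k_def ind norm_quat_parts[of q] snd_conv)
  qed
  also have "\<dots> = (\<integral>\<^sup>+p. ennreal (2 * pi * (snd p)\<^sup>2) * k (fst p, \<bar>snd p\<bar>) \<partial>lborel)"
    by (rule nn_integral_lborel_axis) fact
  also have "\<dots> = (\<integral>\<^sup>+p. ennreal (2 / pi * (norm p)\<^sup>2 * indicator (ball 0 1) p) * h (fst (sgn p), \<bar>snd (sgn p)\<bar>) \<partial>lborel)"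
  proof (rule nn_integral_cong_AE, use AE_snd_nonzero in eventually_elim)
    fix p :: "real \<times> real" assume p: "snd p \<noteq> 0"
    have n: "norm (fst p, \<bar>snd p\<bar>) = norm p" by (simp add: norm_prod_def)
    have s: "sgn (fst p, \<bar>snd p\<bar>) = (fst (sgn p), \<bar>snd (sgn p)\<bar>)"
      by (simp add: sgn_div_norm n abs_mult)
    have "(fst p, \<bar>snd p\<bar>) \<noteq> 0"
      using p by (simp add: prod_eq_iff)
    then have "(fst p, \<bar>snd p\<bar>) \<in> ball 0 1 - {0} \<longleftrightarrow> p \<in> ball 0 1"
      by (simp only: Diff_iff mem_ball_0 n singleton_iff simp_thms)
    then have i: "indicator (ball 0 1 - {0}) (fst p, \<bar>snd p\<bar>) = ennreal (indicator (ball 0 1) p)"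
      by (simp add: indicator_def)
    have w1: "ennreal (2 / pi * (norm p)\<^sup>2 * indicator (ball 0 1) p)
        = ennreal (2 / pi * (norm p)\<^sup>2) * ennreal (indicator (ball 0 1) p)"
      by (rule ennreal_mult) auto
    have w2: "ennreal (2 * pi * (snd p)\<^sup>2) * ennreal ((norm p)\<^sup>2 / (pi\<^sup>2 * (snd p)\<^sup>2)) = ennreal (2 / pi * (norm p)\<^sup>2)"
      using p by (subst ennreal_mult[symmetric]) (auto simp: field_simps power2_eq_square)
    show "ennreal (2 * pi * (snd p)\<^sup>2) * k (fst p, \<bar>snd p\<bar>) =
        ennreal (2 / pi * (norm p)\<^sup>2 * indicator (ball 0 1) p) * h (fst (sgn p), \<bar>snd (sgn p)\<bar>)"
      unfolding k_def n s i w1 w2[symmetric] snd_conv power2_abs by (simp only: mult_ac)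
  qed
  finally show ?thesis .
qed

text \<open>Both sides are the volume of the unit ball in four dimensions.\<close>

lemma nn_integral_disc_snd: "(\<integral>\<^sup>+p. ennreal (2 * pi * (snd p)\<^sup>2 * indicator (ball (0 :: real \<times> real) 1) p) \<partial>lborel) = ennreal (pi\<^sup>2 / 2)"
proof -
  have "ennreal (pi\<^sup>2 / 2) = emeasure lborel (ball (0 :: quat) 1)"
    by (simp add: emeasure_ball unit_ball_vol_4)
  also have "\<dots> = (\<integral>\<^sup>+q. indicator (ball 0 1) (Req q, norm (Imq q)) \<partial>(lborel :: quat measure))"
  proof -
    have "indicator (ball 0 1) (Req q, norm (Imq q)) = (indicator (ball 0 1) q :: ennreal)" for q
      by (simp only: indicator_def mem_ball_0 norm_quat_parts[of q])
    then show ?thesis by simp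
  qed
  also have "\<dots> = (\<integral>\<^sup>+p. ennreal (2 * pi * (snd p)\<^sup>2) * indicator (ball (0 :: real \<times> real) 1) (fst p, \<bar>snd p\<bar>) \<partial>lborel)"
    by (rule nn_integral_lborel_axis, rule borel_measurable_indicator) simp
  also have "\<dots> = (\<integral>\<^sup>+p. ennreal (2 * pi * (snd p)\<^sup>2 * indicator (ball (0 :: real \<times> real) 1) p) \<partial>lborel)"
    by (intro nn_integral_cong) (auto simp: indicator_def norm_prod_def)
  finally show ?thesis by simp
qed

lemma nn_integral_rotation:
  assumes "cos (\<theta> / 2) \<noteq> 0" and [measurable]: "h \<in> borel_measurable borel"
  shows "(\<integral>\<^sup>+p. h (rotation \<theta> p) \<partial>lborel) = (\<integral>\<^sup>+p. h p \<partial>lborel)"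
  by (subst (2) distr_rotation_lborel[OF assms(1), symmetric]) (simp add: nn_integral_distr)

lemma norm_rotation [simp]: "norm (rotation \<theta> p) = norm p"
proof -
  have "(cos \<theta> * fst p - sin \<theta> * snd p)\<^sup>2 + (sin \<theta> * fst p + cos \<theta> * snd p)\<^sup>2
      = ((sin \<theta>)\<^sup>2 + (cos \<theta>)\<^sup>2) * ((fst p)\<^sup>2 + (snd p)\<^sup>2)" by algebra
  then show ?thesis by (simp add: rotation_def norm_prod_def)
qed

text \<open>The total mass is the integral of \<open>2 / \<pi> (x\<^sup>2 + y\<^sup>2)\<close> over the disc. A rotation by \<open>\<pi> / 2\<close>
  exchanges \<open>x\<^sup>2\<close> and \<open>y\<^sup>2\<close>, so both terms have the integral known from the volume of the
  four-dimensional ball.\<close>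

lemma emeasure_slice_measure: "emeasure slice_measure (sphere 0 1) = 1"
proof -
  let ?h = "\<lambda>p::real \<times> real. ennreal (2 * pi * (snd p)\<^sup>2 * indicator (ball 0 1) p)"
  have meas [measurable]: "?h \<in> borel_measurable borel"
    by (intro measurable_compose[OF _ measurable_ennreal] borel_measurable_times borel_measurable_indicator
        borel_measurable_continuous_onI continuous_intros) auto
  have rotation: "rotation (pi / 2) p = (- snd p, fst p)" for p by (simp add: rotation_def)
  have [measurable]: "(\<lambda>p. ?h (rotation (pi / 2) p)) \<in> borel_measurable borel" by measurable
  have c: "cos (pi / 2 / 2) \<noteq> 0"
    using cos_gt_zero[of "pi / 4"] pi_gt_zero by simp
  have hr: "(\<integral>\<^sup>+p. ?h (rotation (pi / 2) p) \<partial>lborel) = ennreal (pi\<^sup>2 / 2)"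
    by (rule trans[OF nn_integral_rotation[OF c meas] nn_integral_disc_snd])
  have "emeasure slice_measure (sphere 0 1) = emeasure slice_measure (space slice_measure)" by simp
  also have "\<dots> = (\<integral>\<^sup>+q. (\<lambda>_. 1) (Req q, norm (Imq q)) \<partial>slice_measure)"
    by simp
  also have "\<dots> = (\<integral>\<^sup>+p. ennreal (2 / pi * (norm p)\<^sup>2 * indicator (ball (0 :: real \<times> real) 1) p) \<partial>lborel)"
    by (subst nn_integral_slice_measure_axis) auto
  also have "\<dots> = (\<integral>\<^sup>+p. ennreal (1 / pi\<^sup>2) * (?h (rotation (pi / 2) p) + ?h p) \<partial>lborel)"
  proof (intro nn_integral_cong)
    fix p :: "real \<times> real"
    have "rotation (pi / 2) p \<in> ball 0 1 \<longleftrightarrow> p \<in> ball 0 1" by simp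
    then have i: "indicator (ball 0 1) (rotation (pi / 2) p) = (indicator (ball 0 1) p :: real)"
      by (simp add: indicator_def)
    have "(norm p)\<^sup>2 = (fst p)\<^sup>2 + (snd p)\<^sup>2" by (simp add: norm_prod_def)
    then have eq: "2 / pi * (norm p)\<^sup>2 * indicator (ball 0 1) p = 1 / pi\<^sup>2 * (2 * pi * (fst p)\<^sup>2 * indicator (ball 0 1) p
        + 2 * pi * (snd p)\<^sup>2 * indicator (ball 0 1) p)"
      by (simp add: field_simps power2_eq_square)
    have dist: "ennreal (1 / pi\<^sup>2 * (2 * pi * x\<^sup>2 * indicator (ball 0 1) p + 2 * pi * y\<^sup>2 * indicator (ball 0 1) p))
        = ennreal (1 / pi\<^sup>2) * (ennreal (2 * pi * x\<^sup>2 * indicator (ball 0 1) p) + ennreal (2 * pi * y\<^sup>2 * indicator (ball 0 1) p))"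
      for x y by (subst ennreal_mult) auto
    have h_rotation: "?h (rotation (pi / 2) p) = ennreal (2 * pi * (fst p)\<^sup>2 * indicator (ball 0 1) p)"
      unfolding i by (simp add: rotation)
    show "ennreal (2 / pi * (norm p)\<^sup>2 * indicator (ball 0 1) p) = ennreal (1 / pi\<^sup>2) * (?h (rotation (pi / 2) p) + ?h p)"
      unfolding eq dist h_rotation ..
  qed
  also have "\<dots> = ennreal (1 / pi\<^sup>2) * (ennreal (pi\<^sup>2 / 2) + ennreal (pi\<^sup>2 / 2))"
    by (subst nn_integral_cmult, measurable, subst nn_integral_add, measurable) (simp only: hr nn_integral_disc_snd)
  also have "\<dots> = 1"
    by (subst ennreal_plus[symmetric], simp, simp, subst ennreal_mult[symmetric]) simp_all
  finally show ?thesis .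
qed

lemma finite_measure_slice_measure: "finite_measure slice_measure"
  by (rule finite_measureI) (simp add: emeasure_slice_measure)

lemma distr_slice_measure_axis:
  "distr slice_measure borel (\<lambda>q. (Req q, norm (Imq q)))
    = distr (density lborel (\<lambda>p. ennreal (2 / pi * (norm p)\<^sup>2 * indicator (ball 0 1) p))) borel
        (\<lambda>p. (fst (sgn p), \<bar>snd (sgn p)\<bar>))" (is "?L = distr (density lborel ?w) borel ?f")
proof (rule measure_eqI)
  fix A assume "A \<in> sets ?L"
  then have A [measurable]: "A \<in> sets borel" by simp
  have w [measurable]: "?w \<in> borel_measurable borel"
    by (intro measurable_compose[OF _ measurable_ennreal] borel_measurable_times borel_measurable_indicator
        borel_measurable_continuous_onI continuous_intros) auto
  have m: "(\<lambda>q. (Req q, norm (Imq q))) \<in> slice_measure \<rightarrow>\<^sub>M borel"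
    by (rule measurable_sphere_measure) measurable
  have "emeasure ?L A = (\<integral>\<^sup>+q. indicator A (Req q, norm (Imq q)) \<partial>slice_measure)"
    by (simp add: nn_integral_indicator[symmetric] nn_integral_distr m del: nn_integral_indicator)
  also have "\<dots> = (\<integral>\<^sup>+p. ?w p * indicator A (?f p) \<partial>lborel)"
    by (rule nn_integral_slice_measure_axis) measurable
  also have "\<dots> = (\<integral>\<^sup>+p. indicator A (?f p) \<partial>density lborel ?w)"
    by (subst nn_integral_density) (use w in measurable)
  also have "\<dots> = emeasure (distr (density lborel ?w) borel ?f) A"
    by (simp add: nn_integral_indicator[symmetric] nn_integral_distr del: nn_integral_indicator)
  finally show "emeasure ?L A = emeasure (distr (density lborel ?w) borel ?f) A" .
qed simp

text \<open>For an integrand that is even in the second coordinate, the absolute value in the disc formula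
  disappears, so that the formula is compatible with rotations.\<close>

lemma integral_slice_measure_axis:
  fixes g :: "real \<times> real \<Rightarrow> real"
  assumes [measurable]: "g \<in> borel_measurable borel" and even: "\<And>x y. g (x, - y) = g (x, y)"
  shows "(\<integral>q. g (Req q, norm (Imq q)) \<partial>slice_measure)
    = (\<integral>p. 2 / pi * (norm p)\<^sup>2 * indicator (ball 0 1) p * g (sgn p) \<partial>lborel)"
proof -
  have m: "(\<lambda>q. (Req q, norm (Imq q))) \<in> slice_measure \<rightarrow>\<^sub>M borel"
    by (rule measurable_sphere_measure) measurable
  have w: "(\<lambda>p::real \<times> real. 2 / pi * (norm p)\<^sup>2 * indicator (ball 0 1) p) \<in> borel_measurable borel"
    by (intro borel_measurable_times borel_measurable_indicator
        borel_measurable_continuous_onI continuous_intros) auto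
  have "g (x, \<bar>y\<bar>) = g (x, y)" for x y
    using even by (cases "0 \<le> y") auto
  then have ev: "g (fst p, \<bar>snd p\<bar>) = g p" for p by simp
  have "(\<integral>q. g (Req q, norm (Imq q)) \<partial>slice_measure) = (\<integral>p. g p \<partial>distr slice_measure borel (\<lambda>q. (Req q, norm (Imq q))))"
    by (rule integral_distr[OF m, symmetric]) measurable
  also have "\<dots> = (\<integral>p. g (sgn p) \<partial>density lborel (\<lambda>p. ennreal (2 / pi * (norm p)\<^sup>2 * indicator (ball 0 1) p)))"
    unfolding distr_slice_measure_axis by (subst integral_distr) (measurable, simp add: ev)
  also have "\<dots> = (\<integral>p. (2 / pi * (norm p)\<^sup>2 * indicator (ball 0 1) p) *\<^sub>R g (sgn p) \<partial>lborel)"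
    by (rule integral_density) (use w in \<open>auto simp del: times_divide_eq_left\<close>)
  finally show ?thesis by simp
qed

lemma nn_integral_cnjq_slice_measure:
  assumes [measurable]: "h \<in> borel_measurable borel"
  shows "(\<integral>\<^sup>+q. h (cnjq q) \<partial>slice_measure) = (\<integral>\<^sup>+q. h q \<partial>slice_measure)"
proof -
  let ?k = "\<lambda>q. ennreal ((norm q)\<^sup>2 / (pi\<^sup>2 * (norm (Imq q))\<^sup>2)) * h (sgn q) * indicator (ball 0 1 - {0}) q"
  have w: "(\<lambda>q. ennreal ((norm q)\<^sup>2 / (pi\<^sup>2 * (norm (Imq q))\<^sup>2))) \<in> borel_measurable borel"
    by (intro measurable_compose[OF _ measurable_ennreal] borel_measurable_divide
        borel_measurable_continuous_onI continuous_intros)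
  have hs: "(\<lambda>p. h (sgn p)) \<in> borel_measurable borel" by measurable
  have [measurable]: "?k \<in> borel_measurable borel"
    by (intro borel_measurable_times_ennreal borel_measurable_indicator w hs) simp
  have "(\<integral>\<^sup>+q. h q \<partial>slice_measure) = (\<integral>\<^sup>+q. ?k q \<partial>distr lborel borel cnjq)"
    by (simp add: nn_integral_slice_measure distr_cnjq_lborel)
  also have "\<dots> = (\<integral>\<^sup>+q. ?k (cnjq q) \<partial>lborel)"
    by (rule nn_integral_distr) measurable
  also have "\<dots> = (\<integral>\<^sup>+q. h (cnjq q) \<partial>slice_measure)"
  proof (subst nn_integral_slice_measure, measurable, intro nn_integral_cong)
    fix q
    have "Imq (cnjq q) = - Imq q" "cnjq (sgn q) = sgn (cnjq q)"
      by (simp_all add: quat_eq_iff sgn_div_norm)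
    moreover have "cnjq q = 0 \<longleftrightarrow> q = 0" by (simp add: quat_eq_iff)
    then have "indicator (ball 0 1 - {0}) (cnjq q) = (indicator (ball 0 1 - {0}) q :: ennreal)"
      by (simp add: indicator_def)
    ultimately show "?k (cnjq q) = ennreal ((norm q)\<^sup>2 / (pi\<^sup>2 * (norm (Imq q))\<^sup>2)) * h (cnjq (sgn q))
        * indicator (ball 0 1 - {0}) q" by simp
  qed
  finally show ?thesis by simp
qed

section \<open>Moments of the slice measure and Parseval identity\<close>

instance quat :: banach ..

text \<open>The isomorphism of \<open>\<complex>\<close> with the slice spanned by 1 and \<open>I\<close>; it transfers powers,
  conjugation and derivatives from the complex numbers to a slice.\<close>

definition slice_emb :: "quat \<Rightarrow> complex \<Rightarrow> quat"
  where "slice_emb I z = slice_point I (Re z) (Im z)"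

lemma imag_unitsD:
  assumes "I \<in> \<S>"
  shows "I * I = - 1" "Req I = 0" "cnjq I = - I" "norm I = 1"
proof -
  show sq: "I * I = - 1" using assms by (simp add: imag_units_def power2_eq_square)
  show re: "Req I = 0"
  proof (rule ccontr)
    assume r: "Req I \<noteq> 0"
    have "Im1 (I * I) = 0" "Im2 (I * I) = 0" "Im3 (I * I) = 0" "Req (I * I) = - 1" by (simp_all add: sq)
    then have "Im1 I = 0" "Im2 I = 0" "Im3 I = 0" and "(Req I)\<^sup>2 = - 1 + (Im1 I)\<^sup>2 + (Im2 I)\<^sup>2 + (Im3 I)\<^sup>2"
      using r by (simp_all add: power2_eq_square)
    then have "(Req I)\<^sup>2 = - 1" by simp
    then show False using zero_le_power2[of "Req I"] by simp
  qed
  show "cnjq I = - I" by (simp add: quat_eq_iff re)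
  have "(norm I)\<^sup>2 = norm (I * I)" by (simp add: norm_mult power2_eq_square)
  then show "norm I = 1" using norm_ge_zero[of I] by (simp add: sq power2_eq_1_iff)
qed

lemma slice_emb_alt: "slice_emb I z = of_real (Re z) + of_real (Im z) * I"
  by (simp add: slice_emb_def slice_point_def)

lemma bounded_linear_emb: "bounded_linear (slice_emb I)"
proof (rule bounded_linear_intro[where K = "1 + norm I"])
  fix z w :: complex and r :: real
  show "slice_emb I (z + w) = slice_emb I z + slice_emb I w" by (simp add: slice_emb_alt algebra_simps)
  show "slice_emb I (r *\<^sub>R z) = r *\<^sub>R slice_emb I z" by (simp add: slice_emb_alt scaleR_conv_of_real algebra_simps)
  have "norm (slice_emb I z) \<le> \<bar>Re z\<bar> + \<bar>Im z\<bar> * norm I"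
    unfolding slice_emb_alt by (rule order_trans[OF norm_triangle_ineq]) (simp add: norm_mult)
  also have "\<dots> \<le> norm z * (1 + norm I)"
    using mult_right_mono[OF abs_Im_le_cmod[of z] norm_ge_zero[of I]] abs_Re_le_cmod[of z]
    by (simp add: algebra_simps)
  finally show "norm (slice_emb I z) \<le> norm z * (1 + norm I)" .
qed

lemma slice_emb_mult: "I \<in> \<S> \<Longrightarrow> slice_emb I (z * w) = slice_emb I z * slice_emb I w"
  using imag_unitsD[of I]
  by (simp add: slice_emb_alt algebra_simps flip: mult.assoc of_real_mult)
    (simp add: mult.assoc Reals_def of_real_def)

lemma slice_emb_1 [simp]: "slice_emb I 1 = 1"
  by (simp add: slice_emb_alt)

lemma slice_emb_power: "I \<in> \<S> \<Longrightarrow> slice_emb I (z ^ n) = slice_emb I z ^ n"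
  by (induction n) (simp_all add: slice_emb_mult)

lemma Req_emb: "I \<in> \<S> \<Longrightarrow> Req (slice_emb I z) = Re z"
  by (simp add: slice_emb_alt imag_unitsD)

lemma quat_eq_emb: "\<exists>I\<in>\<S>. q = slice_emb I (Complex (Req q) (norm (Imq q)))"
proof (cases "Imq q = 0")
  case True
  have "Quat 0 1 0 0 \<in> \<S>" by (simp add: imag_units_def quat_eq_iff power2_eq_square)
  moreover have "q = of_real (Req q)" using True by (simp add: Imq_def)
  ultimately show ?thesis by (intro bexI[of _ "Quat 0 1 0 0"]) (auto simp: slice_emb_alt True)
next
  case False
  let ?I = "Imq q /\<^sub>R norm (Imq q)"
  have "Imq q * Imq q = - of_real ((norm (Imq q))\<^sup>2)"
    by (simp add: quat_eq_iff norm_quat_def power2_eq_square)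
  then have "?I \<in> \<S>"
    using False by (simp add: imag_units_def power2_eq_square of_real_def field_simps)
  moreover have "of_real (norm (Imq q)) * ?I = Imq q"
    using False by (simp add: of_real_def)
  then have "q = slice_emb ?I (Complex (Req q) (norm (Imq q)))"
    by (simp add: slice_emb_alt) (simp add: Imq_def)
  ultimately show ?thesis by blast
qed

text \<open>Every quaternion lies in a slice, and there the power is a complex power.\<close>

lemma Req_power: "Req (q ^ k) = Re (Complex (Req q) (norm (Imq q)) ^ k)"
proof -
  obtain I where I: "I \<in> \<S>" "q = slice_emb I (Complex (Req q) (norm (Imq q)))" using quat_eq_emb by blast
  then show ?thesis by (metis slice_emb_power Req_emb)
qed

lemma integrable_slice_measure:
  fixes f :: "quat \<Rightarrow> 'b :: {banach, second_countable_topology}"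
  assumes "f \<in> borel_measurable borel" and "\<And>q. norm q = 1 \<Longrightarrow> norm (f q) \<le> B"
  shows "integrable slice_measure f"
  by (rule finite_measure.integrable_const_bound[OF finite_measure_slice_measure, where B = B])
    (use assms in \<open>auto intro!: AE_I2 measurable_sphere_measure\<close>)

lemma integral_rotation:
  fixes h :: "real \<times> real \<Rightarrow> real"
  assumes "cos (\<theta> / 2) \<noteq> 0" and [measurable]: "h \<in> borel_measurable borel"
  shows "(\<integral>p. h (rotation \<theta> p) \<partial>lborel) = (\<integral>p. h p \<partial>lborel)"
  by (subst (2) distr_rotation_lborel[OF assms(1), symmetric]) (simp add: integral_distr)

lemma Complex_rotation: "Complex (fst (rotation \<theta> p)) (snd (rotation \<theta> p)) = cis \<theta> * Complex (fst p) (snd p)"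
  by (simp add: rotation_def complex_eq_iff)

lemma sgn_rotation: "sgn (rotation \<theta> p) = rotation \<theta> (sgn p)"
  unfolding sgn_div_norm norm_rotation by (simp add: rotation_def algebra_simps)

text \<open>Rotating the disc by \<open>\<pi> / k\<close> changes the sign of \<open>Re (z ^ k)\<close>. The rotation is applied as two
  rotations by half this angle: for \<open>k = 1\<close> the angle is \<open>\<pi>\<close>, which is not a product of three
  shears.\<close>

lemma integral_Req_power:
  assumes "0 < k"
  shows "(\<integral>q. Req (q ^ k) \<partial>slice_measure) = 0"
proof -
  define g where "g p = Re (Complex (fst p) (snd p) ^ k)" for p :: "real \<times> real"
  \<comment> \<open>Half of the angle \<open>\<pi> / k\<close>, so that \<open>\<theta> / 2 < \<pi> / 2\<close> also for \<open>k = 1\<close>.\<close>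
  define \<theta> where "\<theta> = pi / (2 * real k)"
  define \<Phi> where "\<Phi> p = 2 / pi * (norm p)\<^sup>2 * indicator (ball 0 1) p * g (sgn p)" for p :: "real \<times> real"
  have g [measurable]: "g \<in> borel_measurable borel"
    unfolding g_def Complex_eq by (intro borel_measurable_continuous_onI continuous_intros)
  have gs: "(\<lambda>p. g (sgn p)) \<in> borel_measurable borel" by measurable
  have Phi [measurable]: "\<Phi> \<in> borel_measurable borel"
    unfolding \<Phi>_def
    by (intro borel_measurable_times gs borel_measurable_indicator borel_measurable_power
        borel_measurable_norm) auto
  have "Complex x (- y) = cnj (Complex x y)" for x y by (simp add: complex_eq_iff)
  then have ev: "g (x, - y) = g (x, y)" for x y
    by (simp add: g_def flip: complex_cnj_power)
  have "0 < \<theta> / 2" "\<theta> / 2 < pi / 2" using assms by (auto simp: \<theta>_def field_simps)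
  then have c: "cos (\<theta> / 2) \<noteq> 0" using cos_gt_zero by fastforce
  have "cis \<theta> ^ k * cis \<theta> ^ k = cis (real (2 * k) * \<theta>)"
    by (simp add: Complex.DeMoivre cis_mult algebra_simps)
  also have "\<dots> = - 1" using assms by (simp add: \<theta>_def)
  finally have cis: "cis \<theta> ^ k * (cis \<theta> ^ k * z) = - z" for z by (simp flip: mult.assoc)
  have "\<Phi> (rotation \<theta> (rotation \<theta> p)) = - \<Phi> p" for p
  proof -
    have "(rotation \<theta> (rotation \<theta> p)) \<in> ball 0 1 \<longleftrightarrow> p \<in> ball 0 1" by simp
    then have "indicator (ball 0 1) (rotation \<theta> (rotation \<theta> p)) = (indicator (ball 0 1) p :: real)"
      by (simp add: indicator_def)
    moreover have "g (rotation \<theta> (rotation \<theta> p)) = - g p" for p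
      unfolding g_def Complex_rotation by (simp add: power_mult_distrib cis)
    ultimately show ?thesis by (simp add: \<Phi>_def sgn_rotation)
  qed
  then have "- (\<integral>p. \<Phi> p \<partial>lborel) = (\<integral>p. \<Phi> (rotation \<theta> (rotation \<theta> p)) \<partial>lborel)" by simp
  also have "\<dots> = (\<integral>p. \<Phi> (rotation \<theta> p) \<partial>lborel)"
    by (rule integral_rotation[OF c, of "\<lambda>p. \<Phi> (rotation \<theta> p)"]) measurable
  also have "\<dots> = (\<integral>p. \<Phi> p \<partial>lborel)" by (rule integral_rotation[OF c]) measurable
  finally have "(\<integral>p. \<Phi> p \<partial>lborel) = 0" by simp
  moreover have "(\<integral>q. Req (q ^ k) \<partial>slice_measure) = (\<integral>q. g (Req q, norm (Imq q)) \<partial>slice_measure)"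
    by (simp add: Req_power g_def)
  ultimately show ?thesis using integral_slice_measure_axis[OF g ev] by (simp add: \<Phi>_def)
qed

lemma measurable_quat_power [measurable]: "(\<lambda>q::quat. q ^ n) \<in> borel_measurable borel"
  by (intro borel_measurable_continuous_onI continuous_intros)

lemma integral_cnjq:
  fixes f :: "quat \<Rightarrow> quat"
  assumes [measurable]: "f \<in> borel_measurable borel"
  shows "(\<integral>q. f (cnjq q) \<partial>slice_measure) = (\<integral>q. f q \<partial>slice_measure)"
proof -
  have m: "cnjq \<in> slice_measure \<rightarrow>\<^sub>M borel" "(\<lambda>q. q) \<in> slice_measure \<rightarrow>\<^sub>M borel"
    by (intro measurable_sphere_measure; measurable)+
  have "distr slice_measure borel cnjq = distr slice_measure borel (\<lambda>q. q)" (is "?L = ?R")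
  proof (rule measure_eqI)
    fix A assume "A \<in> sets ?L"
    then have A [measurable]: "A \<in> sets borel" by simp
    have "emeasure ?L A = (\<integral>\<^sup>+q. indicator A (cnjq q) \<partial>slice_measure)"
      by (simp add: nn_integral_indicator[symmetric] nn_integral_distr m del: nn_integral_indicator)
    also have "\<dots> = (\<integral>\<^sup>+q. indicator A q \<partial>slice_measure)"
      by (rule nn_integral_cnjq_slice_measure) measurable
    also have "\<dots> = emeasure ?R A"
      by (simp add: nn_integral_indicator[symmetric] nn_integral_distr m del: nn_integral_indicator)
    finally show "emeasure ?L A = emeasure ?R A" .
  qed simp
  then show ?thesis using integral_distr[OF m(1), of f] integral_distr[OF m(2), of f] by simp
qed

text \<open>The measure is invariant under conjugation, so the moment is real; its real part vanishes by
  rotation.\<close>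

lemma integral_power:
  "(\<integral>q. q ^ k \<partial>slice_measure) = (if k = 0 then 1 else 0)"
proof (cases "k = 0")
  case True
  then show ?thesis
    by (simp add: measure_def emeasure_slice_measure of_real_def)
next
  case False
  have int: "integrable slice_measure (\<lambda>q. q ^ k)"
    by (rule integrable_slice_measure[where B = 1]) (auto simp: norm_power)
  let ?m = "\<integral>q. q ^ k \<partial>slice_measure"
  have "?m = (\<integral>q. cnjq (q ^ k) \<partial>slice_measure)"
    unfolding cnjq_power by (rule integral_cnjq[symmetric]) measurable
  then have sym: "?m = cnjq ?m"
    using integral_bounded_linear[OF bounded_linear_cnjq int] by simp
  have re: "Req ?m = 0"
    using integral_bounded_linear[OF bounded_linear_Req int] integral_Req_power[of k] False by simp
  have "?m = 0"
    using sym re unfolding quat_eq_iff by simp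
  then show ?thesis using False by simp
qed

lemma cnjq_power_mult_power:
  assumes "norm q = 1"
  shows "cnjq q ^ m * q ^ m = 1"
proof (induction m)
  case (Suc m)
  have "cnjq q ^ Suc m * q ^ Suc m = cnjq q ^ m * (cnjq q * q) * q ^ m"
    unfolding power_Suc2[of "cnjq q"] power_Suc[of q] by (simp only: mult.assoc)
  then show ?case using assms Suc by (simp add: cnjq_mult_self)
qed simp

lemma integral_cnjq_power_mult_power:
  "(\<integral>q. cnjq q ^ m * q ^ n \<partial>slice_measure) = (if m = n then 1 else 0)"
proof (cases "m \<le> n")
  case True
  have "(\<integral>q. cnjq q ^ m * q ^ n \<partial>slice_measure) = (\<integral>q. q ^ (n - m) \<partial>slice_measure)"
  proof (rule Bochner_Integration.integral_cong)
    fix q assume "q \<in> space slice_measure"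
    then have "norm q = 1" by simp
    moreover have "q ^ n = q ^ m * q ^ (n - m)" using True by (simp flip: power_add)
    ultimately show "cnjq q ^ m * q ^ n = q ^ (n - m)"
      by (simp add: cnjq_power_mult_power flip: mult.assoc)
  qed simp
  then show ?thesis using True by (simp add: integral_power)
next
  case False
  have "(\<integral>q. cnjq q ^ m * q ^ n \<partial>slice_measure) = (\<integral>q. cnjq q ^ (m - n) \<partial>slice_measure)"
  proof (rule Bochner_Integration.integral_cong)
    fix q assume "q \<in> space slice_measure"
    then have "norm q = 1" by simp
    moreover have "cnjq q ^ m = cnjq q ^ (m - n) * cnjq q ^ n" using False by (simp flip: power_add)
    ultimately show "cnjq q ^ m * q ^ n = cnjq q ^ (m - n)"
      by (simp add: cnjq_power_mult_power mult.assoc)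
  qed simp
  also have "\<dots> = (\<integral>q. q ^ (m - n) \<partial>slice_measure)"
    by (rule integral_cnjq) measurable
  finally show ?thesis using False by (simp add: integral_power)
qed

lemma measurable_power_series [measurable]:
  "(\<lambda>q. \<Sum>n. q ^ n * c n :: quat) \<in> borel_measurable borel"
  by (intro borel_measurable_suminf borel_measurable_times) measurable

lemma norm_power_series_le:
  fixes c :: "nat \<Rightarrow> quat"
  assumes "summable (\<lambda>n. norm (c n))" and "norm q \<le> 1"
  shows "summable (\<lambda>n. norm (q ^ n * c n))" "norm (\<Sum>n. q ^ n * c n) \<le> (\<Sum>n. norm (c n))"
proof -
  have le: "norm (q ^ n * c n) \<le> norm (c n)" for n
    using assms(2) by (simp add: norm_mult norm_power mult_left_le_one_le power_le_one)
  show s: "summable (\<lambda>n. norm (q ^ n * c n))"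
    by (rule summable_comparison_test'[OF assms(1), of 0]) (use le in simp)
  show "norm (\<Sum>n. q ^ n * c n) \<le> (\<Sum>n. norm (c n))"
    by (rule order_trans[OF summable_norm[OF s] suminf_le[OF le s assms(1)]])
qed

lemma integral_cnjq_power_mult_series:
  fixes c :: "nat \<Rightarrow> quat"
  assumes c: "summable (\<lambda>n. norm (c n))"
  shows "(\<integral>q. cnjq q ^ m * (\<Sum>n. q ^ n * c n) \<partial>slice_measure) = c m"
proof -
  let ?f = "\<lambda>n q. cnjq q ^ m * q ^ n * c n"
  have n: "norm (?f n q) = norm (c n)" if "norm q = 1" for n q
    using that by (simp add: norm_mult norm_power)
  have [measurable]: "(\<lambda>q. cnjq q ^ m * q ^ n) \<in> borel_measurable borel" for n
    by (intro borel_measurable_times) measurable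
  have int: "integrable slice_measure (\<lambda>q. cnjq q ^ m * q ^ n)" for n
    by (rule integrable_slice_measure[where B = 1]) (simp_all add: norm_mult norm_power)
  have "(\<lambda>n. \<integral>q. ?f n q \<partial>slice_measure) sums (\<integral>q. (\<Sum>n. ?f n q) \<partial>slice_measure)"
  proof (rule sums_integral)
    show "integrable slice_measure (?f n)" for n using int by simp
    show "AE q in slice_measure. summable (\<lambda>n. norm (?f n q))"
      using c by (intro AE_I2) (simp add: n)
    have "(\<integral>q. norm (?f n q) \<partial>slice_measure) = (\<integral>q. norm (c n) \<partial>slice_measure)" for n
      by (rule Bochner_Integration.integral_cong) (simp_all add: n)
    then show "summable (\<lambda>n. \<integral>q. norm (?f n q) \<partial>slice_measure)"
      using c by (simp add: measure_def emeasure_slice_measure)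
  qed
  moreover have "(\<integral>q. ?f n q \<partial>slice_measure) = (if n = m then c m else 0)" for n
    using int by (simp add: integral_cnjq_power_mult_power)
  moreover have "(\<lambda>n. if n = m then c m else 0) sums c m"
    using sums_single[of m "\<lambda>_. c m"] by simp
  moreover have "(\<integral>q. (\<Sum>n. ?f n q) \<partial>slice_measure) = (\<integral>q. cnjq q ^ m * (\<Sum>n. q ^ n * c n) \<partial>slice_measure)"
  proof (rule Bochner_Integration.integral_cong)
    fix q assume "q \<in> space slice_measure"
    then have "summable (\<lambda>n. q ^ n * c n)"
      using norm_power_series_le(1)[OF c, of q] by (simp add: summable_norm_cancel)
    then show "(\<Sum>n. ?f n q) = cnjq q ^ m * (\<Sum>n. q ^ n * c n)"
      by (simp add: mult.assoc suminf_mult)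
  qed simp
  ultimately show ?thesis by (simp add: sums_unique2)
qed

lemma sums_cnjq: "f sums s \<Longrightarrow> (\<lambda>n. cnjq (f n)) sums cnjq s"
  by (rule bounded_linear.sums[OF bounded_linear_cnjq])

text \<open>The sums over both factors are taken out of the integral one after the other; absolute
  summability of the coefficients dominates both series on the sphere.\<close>

lemma slice_Parseval:
  fixes c d :: "nat \<Rightarrow> quat"
  assumes c: "summable (\<lambda>n. norm (c n))" and d: "summable (\<lambda>n. norm (d n))"
  shows "(\<lambda>n. cnjq (d n) * c n) sums
    (\<integral>q. cnjq (\<Sum>n. q ^ n * d n) * (\<Sum>n. q ^ n * c n) \<partial>slice_measure)"
proof -
  define F where "F q = (\<Sum>n. q ^ n * c n)" for q
  have [measurable]: "F \<in> borel_measurable borel" unfolding F_def by measurable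
  let ?f = "\<lambda>n q. cnjq (d n) * (cnjq q ^ n * F q)"
  define C where "C = (\<Sum>n. norm (c n))"
  have FC: "norm (F q) \<le> C" if "norm q = 1" for q
    unfolding F_def C_def using that by (intro norm_power_series_le(2)[OF c]) simp
  have [measurable]: "(\<lambda>q. cnjq q ^ n * F q) \<in> borel_measurable borel" for n
    by (intro borel_measurable_times) measurable
  have le: "norm (cnjq q ^ n * F q) \<le> C" if "norm q = 1" for n q
    using FC[OF that] that by (simp add: norm_mult norm_power)
  have int: "integrable slice_measure (\<lambda>q. cnjq q ^ n * F q)" for n
    by (rule integrable_slice_measure[where B = C]) (simp_all add: le)
  have dle: "norm (?f n q) \<le> norm (d n) * C" if "norm q = 1" for n q
    using le[OF that] by (simp add: norm_mult[of "cnjq (d n)"] mult_left_mono)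
  have dC: "summable (\<lambda>n. norm (d n) * C)" using d by (rule summable_mult2)
  have "(\<lambda>n. \<integral>q. ?f n q \<partial>slice_measure) sums (\<integral>q. (\<Sum>n. ?f n q) \<partial>slice_measure)"
  proof (rule sums_integral)
    show intf: "integrable slice_measure (?f n)" for n using int by simp
    show "AE q in slice_measure. summable (\<lambda>n. norm (?f n q))"
    proof (intro AE_I2)
      fix q assume "q \<in> space slice_measure"
      then show "summable (\<lambda>n. norm (?f n q))"
        by (intro summable_comparison_test'[OF dC, of 0]) (use dle in simp)
    qed
    have "(\<integral>q. norm (?f n q) \<partial>slice_measure) \<le> (\<integral>q. norm (d n) * C \<partial>slice_measure)" for n
      by (rule integral_mono) (use intf dle in \<open>auto intro!: integrable_slice_measure\<close>)
    then show "summable (\<lambda>n. \<integral>q. norm (?f n q) \<partial>slice_measure)"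
      by (intro summable_comparison_test'[OF dC, of 0]) (simp add: measure_def emeasure_slice_measure)
  qed
  moreover have "(\<integral>q. ?f n q \<partial>slice_measure) = cnjq (d n) * c n" for n
    using int integral_cnjq_power_mult_series[OF c, of n] by (simp add: F_def)
  moreover have "(\<integral>q. (\<Sum>n. ?f n q) \<partial>slice_measure)
      = (\<integral>q. cnjq (\<Sum>n. q ^ n * d n) * F q \<partial>slice_measure)"
  proof (rule Bochner_Integration.integral_cong)
    fix q assume "q \<in> space slice_measure"
    then have "summable (\<lambda>n. q ^ n * d n)"
      using norm_power_series_le(1)[OF d, of q] by (simp add: summable_norm_cancel)
    then have "(\<lambda>n. cnjq (q ^ n * d n) * F q) sums (cnjq (\<Sum>n. q ^ n * d n) * F q)"
      by (intro sums_mult2 sums_cnjq summable_sums)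
    then show "(\<Sum>n. ?f n q) = cnjq (\<Sum>n. q ^ n * d n) * F q"
      by (simp add: sums_iff cnjq_power mult.assoc)
  qed simp
  ultimately show ?thesis by (simp add: F_def)
qed

section \<open>Power series with absolutely summable coefficients\<close>

text \<open>If all coefficients before the \<open>n\<close>-th vanish, the series divided by \<open>x ^ n\<close> tends to the
  \<open>n\<close>-th coefficient as \<open>x\<close> tends to 0.\<close>

lemma powser_sums_zero_imp_zero:
  fixes e :: "nat \<Rightarrow> real"
  assumes sums: "\<And>x. \<bar>x\<bar> < 1 \<Longrightarrow> (\<lambda>n. e n * x ^ n) sums 0"
  shows "e n = 0"
proof (induction n rule: less_induct)
  case (less n)
  have "(\<lambda>i. e (i + n) * x ^ i) sums 0" if "x \<noteq> 0" "norm x < 1" for x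
  proof -
    have "(\<lambda>i. e (i + n) * x ^ (i + n)) sums 0"
      using sums[of x] that less by (subst sums_iff_shift) simp
    from sums_mult2[OF this, of "inverse (x ^ n)"] show ?thesis
      using that by (simp add: power_add field_simps)
  qed
  then have "((\<lambda>x::real. 0) \<longlongrightarrow> e (0 + n)) (at 0)"
    by (intro powser_limit_0_strong[where s = 1 and a = "\<lambda>i. e (i + n)"]) auto
  then show ?case by (simp add: tendsto_const_iff)
qed

text \<open>Restrict to real \<open>q\<close> and take inner products with a fixed quaternion; what remains are real power
  series.\<close>

lemma power_series_coeff_unique:
  fixes c d :: "nat \<Rightarrow> quat"
  assumes c: "\<forall>q\<in>\<B>. (\<lambda>n. q ^ n * c n) sums f q" and d: "\<forall>q\<in>\<B>. (\<lambda>n. q ^ n * d n) sums f q"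
  shows "c = d"
proof
  fix n
  have "(c n - d n) \<bullet> b = 0" for b
  proof (rule powser_sums_zero_imp_zero[where e = "\<lambda>n. (c n - d n) \<bullet> b"])
    fix x :: real assume "\<bar>x\<bar> < 1"
    then have "of_real x \<in> \<B>" by simp
    then have "(\<lambda>n. of_real x ^ n * c n - of_real x ^ n * d n) sums (f (of_real x) - f (of_real x))"
      using c d by (intro sums_diff) auto
    then have "(\<lambda>n. (of_real x ^ n * c n - of_real x ^ n * d n) \<bullet> b) sums ((f (of_real x) - f (of_real x)) \<bullet> b)"
      by (rule bounded_linear.sums[OF bounded_linear_inner_left])
    moreover have "(of_real x ^ n * c n - of_real x ^ n * d n) \<bullet> b = ((c n - d n) \<bullet> b) * x ^ n" for n
      by (simp add: of_real_power[symmetric] scaleR_conv_of_real[symmetric] inner_diff_left algebra_simps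
          del: of_real_power)
    ultimately show "(\<lambda>n. ((c n - d n) \<bullet> b) * x ^ n) sums 0" by simp
  qed
  from this[of "c n - d n"] show "c n = d n" by simp
qed

lemma slice_coeff_eq:
  assumes "\<forall>q\<in>\<B>. (\<lambda>n. q ^ n * c n) sums f q"
  shows "slice_coeff f = c"
  unfolding slice_coeff_def
  by (rule the_equality) (use assms power_series_coeff_unique in blast)+

definition summable_fps :: "quat fps \<Rightarrow> bool"
  where "summable_fps F \<longleftrightarrow> summable (\<lambda>n. norm (fps_nth F n))"

text \<open>The series represents the function on the open ball, and its terms are dominated on the closed
  ball by a convergent series of constants: this condition passes to products and gives continuity
  up to the sphere.\<close>

definition expands :: "(quat \<Rightarrow> quat) \<Rightarrow> quat fps \<Rightarrow> bool"
  where "expands f F \<longleftrightarrow> summable_fps F \<and> (\<forall>q\<in>\<B>. (\<lambda>n. q ^ n * fps_nth F n) sums f q)"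

lemma expands_slice_coeff: "expands f F \<Longrightarrow> slice_coeff f = fps_nth F"
  by (rule slice_coeff_eq) (simp add: expands_def)

lemma summable_fps_mult:
  assumes F: "summable_fps F" and G: "summable_fps G"
  shows "summable_fps (F * G)"
  unfolding summable_fps_def
proof (rule summable_comparison_test')
  show "summable (\<lambda>n. \<Sum>i\<le>n. norm (fps_nth F i) * norm (fps_nth G (n - i)))"
  proof (rule summable_Cauchy_product)
    show "summable (\<lambda>k. norm (norm (fps_nth F k)))" using F unfolding summable_fps_def real_norm_def abs_norm_cancel .
    show "summable (\<lambda>k. norm (norm (fps_nth G k)))" using G unfolding summable_fps_def real_norm_def abs_norm_cancel .
  qed
  show "norm (norm (fps_nth (F * G) n)) \<le> (\<Sum>i\<le>n. norm (fps_nth F i) * norm (fps_nth G (n - i)))" if "n \<ge> 0" for n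
    unfolding real_norm_def abs_norm_cancel fps_mult_nth atLeast0AtMost norm_mult[symmetric] by (rule norm_sum)
qed

lemma summable_fps_finite_support: "(\<And>n. N < n \<Longrightarrow> fps_nth F n = 0) \<Longrightarrow> summable_fps F"
  unfolding summable_fps_def by (rule summable_finite[of "{..N}"]) (auto simp: not_le)

lemma expands_suminf:
  assumes "summable_fps F" "\<And>q. q \<in> \<B> \<Longrightarrow> f q = (\<Sum>n. q ^ n * fps_nth F n)"
  shows "expands f F"
  unfolding expands_def
proof (intro conjI ballI)
  fix q :: quat assume q: "q \<in> \<B>"
  then have "summable (\<lambda>n. norm (q ^ n * fps_nth F n))"
    using assms(1) by (intro norm_power_series_le(1)) (simp_all add: summable_fps_def)
  then show "(\<lambda>n. q ^ n * fps_nth F n) sums f q"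
    unfolding assms(2)[OF q] by (rule summable_sums[OF summable_norm_cancel])
qed fact

lemma expands_star_prod:
  assumes "expands f F" "expands g G"
  shows "expands (f \<star> g) (F * G)"
proof (rule expands_suminf)
  show "summable_fps (F * G)" using assms summable_fps_mult by (simp add: expands_def)
  show "(f \<star> g) q = (\<Sum>n. q ^ n * fps_nth (F * G) n)" for q
    by (simp add: star_prod_def expands_slice_coeff[OF assms(1)] expands_slice_coeff[OF assms(2)]
        fps_mult_nth atLeast0AtMost)
qed

lemma expands_regular_conj:
  assumes "expands f F"
  shows "expands (regular_conj f) (Abs_fps (\<lambda>n. cnjq (fps_nth F n)))"
proof (rule expands_suminf)
  show "summable_fps (Abs_fps (\<lambda>n. cnjq (fps_nth F n)))" using assms by (simp add: expands_def summable_fps_def)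
qed (simp add: regular_conj_def expands_slice_coeff[OF assms])

text \<open>When the coefficients of the first factor commute with everything, powers of \<open>q\<close> can be moved
  past them, and the star product is the pointwise product.\<close>

lemma star_prod_central:
  assumes F: "expands f F" and G: "expands g G" and h: "expands h (F * G)" and q: "q \<in> \<B>"
    and central: "\<And>n x. fps_nth F n * x = x * fps_nth F n"
  shows "h q = f q * g q"
proof -
  have "summable (\<lambda>n. norm (q ^ n * fps_nth F n))" "summable (\<lambda>n. norm (q ^ n * fps_nth G n))"
    using F G q by (auto simp: expands_def summable_fps_def intro!: norm_power_series_le(1))
  from Cauchy_product_sums[OF this]
  have "(\<lambda>n. \<Sum>i\<le>n. (q ^ i * fps_nth F i) * (q ^ (n - i) * fps_nth G (n - i))) sums (f q * g q)"
    using F G q by (simp add: expands_def sums_iff)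
  moreover have "(\<Sum>i\<le>n. (q ^ i * fps_nth F i) * (q ^ (n - i) * fps_nth G (n - i))) = q ^ n * fps_nth (F * G) n" for n
  proof -
    have "(q ^ i * fps_nth F i) * (q ^ (n - i) * fps_nth G (n - i)) = q ^ n * (fps_nth F i * fps_nth G (n - i))"
      if "i \<le> n" for i
    proof -
      have "(q ^ i * fps_nth F i) * (q ^ (n - i) * fps_nth G (n - i))
          = q ^ i * (fps_nth F i * q ^ (n - i)) * fps_nth G (n - i)" by (simp only: mult.assoc)
      also have "\<dots> = (q ^ i * q ^ (n - i)) * (fps_nth F i * fps_nth G (n - i))"
        by (simp only: central[of i "q ^ (n - i)"] mult.assoc)
      finally show ?thesis using that by (simp flip: power_add)
    qed
    then show ?thesis by (simp add: fps_mult_nth atLeast0AtMost sum_distrib_left)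
  qed
  ultimately show ?thesis using h q by (simp add: expands_def sums_iff)
qed

text \<open>The series of \<open>u + q v\<close>.\<close>

definition linear_fps :: "quat \<Rightarrow> quat \<Rightarrow> quat fps"
  where "linear_fps u v = fps_const u + fps_const v * fps_X"

lemma linear_fps_nth: "fps_nth (linear_fps u v) n = (if n = 0 then u else if n = 1 then v else 0)"
  by (auto simp: linear_fps_def)

lemma linear_fps_mult_nth:
  "fps_nth (linear_fps u v * G) n = u * fps_nth G n + (if n = 0 then 0 else v * fps_nth G (n - 1))"
  by (simp add: linear_fps_def distrib_right mult.assoc)

lemma expands_linear: "expands (\<lambda>p. u + p * v) (linear_fps u v)"
  unfolding expands_def
proof
  show "summable_fps (linear_fps u v)" by (rule summable_fps_finite_support[where N = 1]) (simp add: linear_fps_nth)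
  show "\<forall>q\<in>\<B>. (\<lambda>n. q ^ n * fps_nth (linear_fps u v) n) sums (u + q * v)"
    using sums_finite[of "{0, 1}" "\<lambda>n. q ^ n * fps_nth (linear_fps u v) n" for q] by (simp add: linear_fps_nth)
qed

text \<open>The series of \<open>(1 - q a')\<^sup>-\<^sup>*\<close>, where \<open>a'\<close> is the conjugate of \<open>a\<close>.\<close>

definition geometric_fps :: "quat \<Rightarrow> quat fps"
  where "geometric_fps a = Abs_fps (\<lambda>n. cnjq a ^ n)"

lemma summable_fps_geom: "a \<in> \<B> \<Longrightarrow> summable_fps (geometric_fps a)"
  by (simp add: summable_fps_def geometric_fps_def norm_power summable_geometric)

lemma linear_geometric_fps: "linear_fps 1 (- cnjq a) * geometric_fps a = 1"
  by (rule fps_ext) (auto simp: linear_fps_mult_nth geometric_fps_def power_eq_if)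

text \<open>With \<open>f = 1 - q a'\<close>, the symmetrization has real coefficients and formally
  \<open>f\<^sup>s * (1 - q a')\<^sup>-\<^sup>* = f\<^sup>c\<close>, which is therefore a pointwise identity \<open>f\<^sup>s(q) S(q) = 1 - q a\<close>.
  The right-hand side has no zero in the ball, so neither has \<open>f\<^sup>s\<close>, and dividing is justified.\<close>

lemma expands_regular_reciprocal:
  assumes a: "a \<in> \<B>"
  shows "expands (regular_reciprocal (\<lambda>p. 1 - p * cnjq a)) (geometric_fps a)"
proof (rule expands_suminf)
  define f where "f p = 1 - p * cnjq a" for p :: quat
  define s where "s = linear_fps 1 (- cnjq a) * linear_fps 1 (- a)"
  have f: "expands f (linear_fps 1 (- cnjq a))"
    using expands_linear[of 1 "- cnjq a"] by (simp add: f_def[abs_def])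
  have "Abs_fps (\<lambda>n. cnjq (fps_nth (linear_fps 1 (- cnjq a)) n)) = linear_fps 1 (- a)"
    by (rule fps_ext) (auto simp: linear_fps_nth quat_eq_iff)
  with expands_regular_conj[OF f] have fc: "expands (regular_conj f) (linear_fps 1 (- a))" by simp
  have fs: "expands (symmetrization f) s"
    unfolding symmetrization_def s_def by (rule expands_star_prod[OF f fc])
  have acomm: "cnjq a * a = a * cnjq a" by (simp add: cnjq_mult_self)
  have central: "fps_nth s n * x = x * fps_nth s n" for n x
  proof -
    have "- a - cnjq a = of_real (- 2 * Req a)" unfolding of_real_def by (simp add: quat_eq_iff)
    then have "- a - cnjq a \<in> \<real>" by (metis Reals_of_real)
    then have "fps_nth s n \<in> \<real>"
      by (auto simp: s_def linear_fps_mult_nth linear_fps_nth cnjq_mult_self)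
    then show ?thesis by (auto elim!: Reals_cases simp: of_real_def)
  qed
  have "s = linear_fps 1 (- a) * linear_fps 1 (- cnjq a)"
    unfolding s_def by (rule fps_ext) (auto simp: linear_fps_mult_nth linear_fps_nth acomm)
  then have sg: "s * geometric_fps a = linear_fps 1 (- a)" by (simp add: mult.assoc linear_geometric_fps)
  show A: "summable_fps (geometric_fps a)" by (rule summable_fps_geom[OF a])
  fix q assume q: "q \<in> \<B>"
  define S where "S q = (\<Sum>n. q ^ n * fps_nth (geometric_fps a) n)" for q
  have S: "expands S (geometric_fps a)" by (rule expands_suminf[OF A]) (simp add: S_def)
  have conj: "regular_conj f q = 1 - q * a"
    using fc expands_linear[of 1 "- a"] q by (auto simp: expands_def dest!: bspec intro: sums_unique2)
  have "norm (q * a) < 1" using q a mult_strict_mono[of "norm q" 1 "norm a" 1] by (simp add: norm_mult)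
  then have "q * a \<noteq> 1" by auto
  moreover have "regular_conj f q = symmetrization f q * S q"
    by (rule star_prod_central[OF fs S _ q central]) (use fc sg in simp)
  ultimately have "symmetrization f q \<noteq> 0" using conj by auto
  then show "regular_reciprocal (\<lambda>p. 1 - p * cnjq a) q = (\<Sum>n. q ^ n * fps_nth (geometric_fps a) n)"
    using \<open>regular_conj f q = symmetrization f q * S q\<close>
    unfolding f_def[symmetric] regular_reciprocal_def S_def[symmetric]
    by (simp flip: mult.assoc)
qed

definition szego_fps :: "quat \<Rightarrow> quat fps"
  where "szego_fps a = fps_const (of_real (sqrt (1 - (norm a)\<^sup>2))) * geometric_fps a"

lemma expands_szego_kernel:
  assumes "a \<in> \<B>"
  shows "expands (szego_kernel a) (szego_fps a)"
  unfolding expands_def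
proof
  show "summable_fps (szego_fps a)" unfolding szego_fps_def
    by (intro summable_fps_mult summable_fps_geom[OF assms] summable_fps_finite_support[where N = 0]) simp
  have "q ^ n * fps_nth (szego_fps a) n = sqrt (1 - (norm a)\<^sup>2) *\<^sub>R (q ^ n * fps_nth (geometric_fps a) n)" for q n
    by (simp add: szego_fps_def scaleR_conv_of_real[symmetric])
  then show "\<forall>q\<in>\<B>. (\<lambda>n. q ^ n * fps_nth (szego_fps a) n) sums szego_kernel a q"
    using expands_regular_reciprocal[OF assms]
    by (auto simp: expands_def szego_kernel_def intro: sums_scaleR_right)
qed

definition blaschke_unit :: "quat \<Rightarrow> quat"
  where "blaschke_unit a = (if a = 0 then 1 else a /\<^sub>R norm a)"

definition blaschke_fps :: "quat \<Rightarrow> quat fps"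
  where "blaschke_fps a = geometric_fps a * (linear_fps a (- 1) * fps_const (blaschke_unit a))"

lemma expands_blaschke_factor:
  assumes "a \<in> \<B>"
  shows "expands (blaschke_factor a) (blaschke_fps a)"
proof -
  let ?u = "blaschke_unit a"
  have "linear_fps a (- 1) * fps_const ?u = linear_fps (a * ?u) (- ?u)"
    by (rule fps_ext) (simp add: linear_fps_nth)
  moreover have "(\<lambda>p. (a - p) * ?u) = (\<lambda>p. a * ?u + p * (- ?u))"
    by (simp add: left_diff_distrib)
  ultimately have "expands (\<lambda>p. (a - p) * ?u) (linear_fps a (- 1) * fps_const ?u)"
    using expands_linear[of "a * ?u" "- ?u"] by simp
  then show ?thesis
    unfolding blaschke_factor_def blaschke_fps_def blaschke_unit_def
    by (rule expands_star_prod[OF expands_regular_reciprocal[OF assms]])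
qed

primrec blaschke_product_fps :: "(nat \<Rightarrow> quat) \<Rightarrow> nat \<Rightarrow> quat fps"
  where
    "blaschke_product_fps a 0 = 1"
  | "blaschke_product_fps a (Suc n) = blaschke_product_fps a n * blaschke_fps (a (Suc n))"

lemma expands_blaschke_product:
  assumes "\<And>k. k \<ge> 1 \<Longrightarrow> a k \<in> \<B>"
  shows "expands (blaschke_product a n) (blaschke_product_fps a n)"
proof (induction n)
  case 0
  have "linear_fps 1 0 = 1" by (rule fps_ext) (simp add: linear_fps_nth)
  then show ?case using expands_linear[of 1 0] by simp
next
  case (Suc n)
  have "expands (blaschke_factor (a (Suc n))) (blaschke_fps (a (Suc n)))"
    by (rule expands_blaschke_factor[OF assms]) simp
  from expands_star_prod[OF Suc this] show ?case by simp
qed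

lemma expands_TM_function:
  assumes "\<And>k. k \<ge> 1 \<Longrightarrow> a k \<in> \<B>" and "k \<ge> 1"
  shows "expands (TM_function a k) (blaschke_product_fps a (k - 1) * szego_fps (a k))"
  unfolding TM_function_def
  by (intro expands_star_prod expands_blaschke_product expands_szego_kernel assms) (use assms in auto)

section \<open>Slice regularity, boundary values and the Hardy inner product\<close>

lemma norm_emb: "I \<in> \<S> \<Longrightarrow> norm (slice_emb I z) = norm z"
proof -
  assume I: "I \<in> \<S>"
  have "Imq (slice_emb I z) = of_real (Im z) * I"
    unfolding Imq_def Req_emb[OF I] by (simp add: slice_emb_alt)
  then have "norm (Imq (slice_emb I z)) = \<bar>Im z\<bar>"
    by (simp add: norm_mult imag_unitsD[OF I])
  then show ?thesis
    by (simp add: norm_quat_parts[of "slice_emb I z"] Req_emb[OF I] norm_prod_def cmod_def)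
qed

lemma slice_emb_0 [simp]: "slice_emb I 0 = 0"
  by (simp add: slice_emb_alt)

lemma slice_point_emb: "slice_point I x y = slice_emb I (Complex x y)"
  by (simp add: slice_emb_def)

text \<open>The restriction of a power series to the slice of \<open>I\<close>, in a complex variable.\<close>

definition slice_series :: "quat \<Rightarrow> (nat \<Rightarrow> quat) \<Rightarrow> complex \<Rightarrow> quat"
  where "slice_series I c z = (\<Sum>n. slice_emb I (z ^ n) * c n)"

text \<open>In contrast to absolute summability of the coefficients, this condition is preserved by
  termwise differentiation.\<close>

definition unit_radius :: "(nat \<Rightarrow> quat) \<Rightarrow> bool"
  where "unit_radius c \<longleftrightarrow> (\<forall>x::real. \<bar>x\<bar> < 1 \<longrightarrow> summable (\<lambda>n. norm (c n) * x ^ n))"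

definition deriv_coeff :: "(nat \<Rightarrow> quat) \<Rightarrow> nat \<Rightarrow> quat"
  where "deriv_coeff c n = real (Suc n) *\<^sub>R c (Suc n)"

lemma unit_radius_deriv_coeff:
  assumes "unit_radius c"
  shows "unit_radius (deriv_coeff c)"
proof -
  have "summable (\<lambda>n. diffs (\<lambda>n. norm (c n)) n * x ^ n)" if "\<bar>x\<bar> < 1" for x :: real
    by (rule termdiff_converges[where K = 1]) (use that assms in \<open>simp_all add: unit_radius_def\<close>)
  then show ?thesis by (simp add: unit_radius_def deriv_coeff_def diffs_def)
qed

text \<open>Within a slice the variable commutes with its increment, so the terms have the derivatives known
  from complex powers. The differentiated series converges uniformly on a slightly smaller closed
  disc, where termwise differentiation is legitimate.\<close>

lemma slice_series_has_derivative:
  assumes I: "I \<in> \<S>" and c: "unit_radius c" and z: "norm z < 1"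
  shows "(slice_series I c has_derivative (\<lambda>h. slice_emb I h * slice_series I (deriv_coeff c) z)) (at z)"
proof -
  obtain r where r: "norm z < r" "r < 1" using dense z by blast
  let ?S = "cball (0 :: complex) r"
  have r0: "0 < r" using r norm_ge_zero[of z] by linarith
  \<comment> \<open>\<open>t n x\<close> is the derivative of the \<open>n\<close>-th term, a series shifted by one against \<open>deriv_coeff\<close>.\<close>
  define t where "t n x = slice_emb I (of_nat n * x ^ (n - 1)) * c n" for n x
  have t0: "t 0 x = 0" for x by (simp add: t_def)
  have tSuc: "t (Suc n) x = slice_emb I (x ^ n) * deriv_coeff c n" for n x
  proof -
    have "of_nat (Suc n) * x ^ n = real (Suc n) *\<^sub>R x ^ n" by (simp add: scaleR_conv_of_real)
    then show ?thesis
      by (simp add: t_def deriv_coeff_def bounded_linear.linear[OF bounded_linear_emb, THEN linear_scale] del: of_nat_Suc)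
  qed
  have M: "summable (\<lambda>n. norm (deriv_coeff c n) * r ^ n)"
    using unit_radius_deriv_coeff[OF c] r r0 by (simp add: unit_radius_def)
  have tle: "norm (t (Suc n) x) \<le> norm (deriv_coeff c n) * r ^ n" if "x \<in> ?S" for n x
    using that by (auto simp: tSuc norm_mult norm_emb[OF I] norm_power mult.commute
        intro!: mult_right_mono power_mono)
  define L where "L = slice_series I (deriv_coeff c)"
  have unif: "uniform_limit ?S (\<lambda>n x. \<Sum>i<n. t (Suc i) x) L sequentially"
    unfolding L_def slice_series_def[abs_def] tSuc[symmetric]
    by (rule Weierstrass_m_test[OF tle M])
  have "\<exists>g. \<forall>x\<in>?S. (\<lambda>n. slice_emb I (x ^ n) * c n) sums (g x) \<and> (g has_derivative (\<lambda>h. slice_emb I h * L x)) (at x within ?S)"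
  proof (rule has_derivative_series[where x = 0 and l = "c 0"])
    show "convex ?S" by simp
    show "((\<lambda>x. slice_emb I (x ^ n) * c n) has_derivative (\<lambda>h. slice_emb I h * t n x)) (at x within ?S)" for n x
    proof -
      have "((\<lambda>x. x ^ n) has_derivative (\<lambda>h. h * (of_nat n * x ^ (n - 1)))) (at x within ?S)"
        by (rule has_derivative_eq_rhs[OF has_derivative_power[OF has_derivative_ident]])
          (simp add: fun_eq_iff mult_ac)
      then have "((\<lambda>x. slice_emb I (x ^ n)) has_derivative (\<lambda>h. slice_emb I (h * (of_nat n * x ^ (n - 1))))) (at x within ?S)"
        by (rule bounded_linear.has_derivative[OF bounded_linear_emb])
      then have "((\<lambda>x. slice_emb I (x ^ n) * c n) has_derivative (\<lambda>h. slice_emb I (h * (of_nat n * x ^ (n - 1))) * c n)) (at x within ?S)"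
        by (rule has_derivative_mult_left)
      then show ?thesis by (simp add: t_def slice_emb_mult[OF I] mult.assoc)
    qed
    show "(0 :: complex) \<in> ?S" using r0 by simp
    have "(\<lambda>n. slice_emb I (0 ^ n) * c n) sums (\<Sum>n\<in>{0}. slice_emb I (0 ^ n) * c n)"
      by (rule sums_finite) (simp_all add: power_0_left)
    then show "(\<lambda>n. slice_emb I (0 ^ n) * c n) sums c 0" by simp
    fix e :: real assume "e > 0"
    then have "\<forall>\<^sub>F n in sequentially. \<forall>x\<in>?S. dist (\<Sum>i<n. t (Suc i) x) (L x) < e"
      using unif by (simp add: uniform_limit_iff)
    then have "\<forall>\<^sub>F n in sequentially. \<forall>x\<in>?S. dist (\<Sum>i<n. t i x) (L x) < e"
      by (subst eventually_sequentially_Suc[symmetric]) (simp add: sum.lessThan_Suc_shift t0 del: sum.lessThan_Suc)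
    then show "\<forall>\<^sub>F n in sequentially. \<forall>x\<in>?S. \<forall>h. norm ((\<Sum>i<n. slice_emb I h * t i x) - slice_emb I h * L x) \<le> e * norm h"
    proof eventually_elim
      case (elim n)
      show ?case
      proof (intro ballI allI)
        fix x h assume x: "x \<in> ?S"
        have "(\<Sum>i<n. slice_emb I h * t i x) - slice_emb I h * L x = slice_emb I h * ((\<Sum>i<n. t i x) - L x)"
          by (simp add: sum_distrib_left right_diff_distrib)
        then have "norm ((\<Sum>i<n. slice_emb I h * t i x) - slice_emb I h * L x) = norm h * dist (\<Sum>i<n. t i x) (L x)"
          by (simp add: norm_mult norm_emb[OF I] dist_norm)
        also have "\<dots> \<le> e * norm h"
          using elim x by (simp add: mult.commute[of e] mult_left_mono less_imp_le)
        finally show "norm ((\<Sum>i<n. slice_emb I h * t i x) - slice_emb I h * L x) \<le> e * norm h" .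
      qed
    qed
  qed
  then obtain g where g: "\<And>x. x \<in> ?S \<Longrightarrow> g x = slice_series I c x"
      "\<And>x. x \<in> ?S \<Longrightarrow> (g has_derivative (\<lambda>h. slice_emb I h * L x)) (at x within ?S)"
    unfolding slice_series_def sums_iff by metis
  have "z \<in> interior ?S" using r by simp
  then have "(g has_derivative (\<lambda>h. slice_emb I h * L z)) (at z)"
    using g(2)[of z] at_within_interior[of z ?S] r by simp
  then show ?thesis
    unfolding L_def[symmetric]
    by (rule has_derivative_transform_within_open[where s = "ball 0 r"]) (use r g(1) in auto)
qed

lemma expands_slice_series:
  assumes "expands f F" "I \<in> \<S>" "norm z < 1"
  shows "(\<lambda>n. slice_emb I (z ^ n) * fps_nth F n) sums f (slice_emb I z)"
    and "f (slice_emb I z) = slice_series I (fps_nth F) z"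
proof -
  show "(\<lambda>n. slice_emb I (z ^ n) * fps_nth F n) sums f (slice_emb I z)"
    using assms by (simp add: expands_def slice_emb_power norm_emb)
  then show "f (slice_emb I z) = slice_series I (fps_nth F) z"
    by (simp add: slice_series_def sums_iff)
qed

text \<open>The representation formula is linear in \<open>f\<close> and compatible with multiplication from the right,
  so it is enough to check it for each power of \<open>q\<close>.\<close>

lemma expands_slice_function:
  assumes f: "expands f F"
  shows "slice_function f"
  unfolding slice_function_def
proof (intro allI ballI impI)
  fix x y I J assume I: "I \<in> \<S>" and J: "J \<in> \<S>" and ball: "slice_point J x y \<in> \<B>"
  let ?z = "Complex x y"
  have z: "norm ?z < 1" using ball by (simp add: slice_point_emb norm_emb[OF J])
  have y: "slice_point I x (- y) = slice_emb I (cnj ?z)"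
    unfolding slice_point_emb by (rule arg_cong[where f = "slice_emb I"]) (simp add: complex_eq_iff)
  note sJ = expands_slice_series(1)[OF f J z] and sI = expands_slice_series(1)[OF f I z]
  have sI': "(\<lambda>n. slice_emb I (cnj ?z ^ n) * fps_nth F n) sums f (slice_emb I (cnj ?z))"
    by (rule expands_slice_series(1)[OF f I]) (use z in simp)
  have slice: "slice_emb J w = (1/2) *\<^sub>R (slice_emb I w + slice_emb I (cnj w)) + (1/2) *\<^sub>R (J * I * (slice_emb I (cnj w) - slice_emb I w))" for w
  proof -
    have "slice_emb I (cnj w) - slice_emb I w = (- 2 * Im w) *\<^sub>R I"
      by (simp add: slice_emb_alt quat_eq_iff)
    then have "J * I * (slice_emb I (cnj w) - slice_emb I w) = (- 2 * Im w) *\<^sub>R (J * (I * I))"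
      by (simp add: mult.assoc)
    also have "\<dots> = (2 * Im w) *\<^sub>R J" by (simp add: imag_unitsD[OF I])
    finally have "J * I * (slice_emb I (cnj w) - slice_emb I w) = (2 * Im w) *\<^sub>R J" .
    moreover have "slice_emb I w + slice_emb I (cnj w) = (2 * Re w) *\<^sub>R 1"
      by (simp add: slice_emb_alt quat_eq_iff)
    ultimately show ?thesis
      by (simp add: slice_emb_alt of_real_def)
  qed
  have "(\<lambda>n. (1/2) *\<^sub>R (slice_emb I (?z ^ n) * fps_nth F n + slice_emb I (cnj ?z ^ n) * fps_nth F n)
      + (1/2) *\<^sub>R (J * I * (slice_emb I (cnj ?z ^ n) * fps_nth F n - slice_emb I (?z ^ n) * fps_nth F n))) sums
      ((1/2) *\<^sub>R (f (slice_emb I ?z) + f (slice_emb I (cnj ?z)))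
      + (1/2) *\<^sub>R (J * I * (f (slice_emb I (cnj ?z)) - f (slice_emb I ?z))))"
    by (intro sums_add sums_scaleR_right sums_mult sums_diff sI sI')
  moreover have "(1/2) *\<^sub>R (slice_emb I (?z ^ n) * fps_nth F n + slice_emb I (cnj ?z ^ n) * fps_nth F n)
      + (1/2) *\<^sub>R (J * I * (slice_emb I (cnj ?z ^ n) * fps_nth F n - slice_emb I (?z ^ n) * fps_nth F n))
      = slice_emb J (?z ^ n) * fps_nth F n" for n
    unfolding slice[of "?z ^ n"] complex_cnj_power
    by (simp only: distrib_right left_diff_distrib right_diff_distrib mult_scaleR_left mult.assoc)
  ultimately show "f (slice_point J x y) = (1/2) *\<^sub>R (f (slice_point I x y) + f (slice_point I x (- y))) +
        (1/2) *\<^sub>R (J * I * (f (slice_point I x (- y)) - f (slice_point I x y)))"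
    unfolding y unfolding slice_point_emb using sJ by (simp add: sums_unique2)
qed

text \<open>The partial derivatives are the series \<open>D\<close> of the derivative and \<open>I D\<close>, and
  \<open>D + I (I D) = 0\<close>.\<close>

lemma expands_slice_regular:
  assumes f: "expands f F"
  shows "slice_regular f"
  unfolding slice_regular_def
proof (intro conjI ballI expands_slice_function[OF f])
  fix I assume I: "I \<in> \<S>"
  let ?c = "fps_nth F"
  define D where "D = slice_series I (deriv_coeff ?c)"
  have c: "unit_radius ?c"
    unfolding unit_radius_def
  proof (intro allI impI)
    fix x :: real assume "\<bar>x\<bar> < 1"
    then have le: "norm (norm (?c n) * x ^ n) \<le> norm (?c n)" for n
      by (simp add: abs_mult power_abs mult_left_le power_le_one)
    have "summable (\<lambda>n. norm (?c n))" using f by (simp add: expands_def summable_fps_def)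
    from summable_comparison_test'[OF this, of 0, OF le] show "summable (\<lambda>n. norm (?c n) * x ^ n)" .
  qed
  have ball: "slice_point I x y \<in> \<B> \<longleftrightarrow> norm (Complex x y) < 1" for x y
    by (simp add: slice_point_emb norm_emb[OF I])
  have "continuous_on (ball 0 1) D"
    unfolding D_def
    by (rule has_derivative_continuous_on[OF has_derivative_at_withinI[OF
          slice_series_has_derivative[OF I unit_radius_deriv_coeff[OF c]]]]) simp
  then have contD: "continuous_on {(x, y). slice_point I x y \<in> \<B>} (\<lambda>p. D (Complex (fst p) (snd p)))"
    unfolding ball Complex_eq by (rule continuous_on_compose2) (auto intro!: continuous_intros)
  have der: "((\<lambda>s. f (slice_emb I (g s))) has_vector_derivative slice_emb I g' * D (g s0)) (at s0)"
    if g: "(g has_vector_derivative g') (at s0)" and s0: "norm (g s0) < 1" for g g' and s0 :: real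
  proof -
    have "((\<lambda>s. slice_series I ?c (g s)) has_derivative (\<lambda>h. slice_emb I (h *\<^sub>R g') * D (g s0))) (at s0)"
      using has_derivative_compose[OF g[unfolded has_vector_derivative_def] slice_series_has_derivative[OF I c s0]]
      by (simp add: D_def)
    then have 1: "((\<lambda>s. slice_series I ?c (g s)) has_vector_derivative slice_emb I g' * D (g s0)) (at s0)"
      by (simp add: has_vector_derivative_def bounded_linear.linear[OF bounded_linear_emb, THEN linear_scale])
    have "isCont g s0" using g by (rule has_vector_derivative_continuous)
    then have "\<forall>\<^sub>F s in nhds s0. g s \<in> ball 0 1"
      using s0 by (intro topological_tendstoD[of g "g s0"]) (auto simp: tendsto_nhds_iff isCont_def)
    then obtain S where S: "open S" "s0 \<in> S" "\<And>s. s \<in> S \<Longrightarrow> norm (g s) < 1"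
      by (auto simp: eventually_nhds)
    show ?thesis
      by (rule has_vector_derivative_transform_within_open[OF 1 S(1,2)])
        (simp add: expands_slice_series(2)[OF f I] S(3))
  qed
  show "\<exists>fx fy :: real \<times> real \<Rightarrow> quat.
      continuous_on {(x, y). slice_point I x y \<in> \<B>} fx \<and>
      continuous_on {(x, y). slice_point I x y \<in> \<B>} fy \<and>
      (\<forall>x y. slice_point I x y \<in> \<B> \<longrightarrow>
        ((\<lambda>s. f (slice_point I s y)) has_vector_derivative fx (x, y)) (at x) \<and>
        ((\<lambda>t. f (slice_point I x t)) has_vector_derivative fy (x, y)) (at y) \<and>
        (1/2) *\<^sub>R (fx (x, y) + I * fy (x, y)) = 0)"
  proof (intro exI conjI allI impI)
    show "continuous_on {(x, y). slice_point I x y \<in> \<B>} (\<lambda>p. D (Complex (fst p) (snd p)))" by (rule contD)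
    show "continuous_on {(x, y). slice_point I x y \<in> \<B>} (\<lambda>p. I * D (Complex (fst p) (snd p)))"
      by (intro continuous_intros contD)
    fix x y assume "slice_point I x y \<in> \<B>"
    then have z: "norm (Complex x y) < 1" by (simp only: ball)
    have "((\<lambda>s. Complex s y) has_vector_derivative 1) (at x)"
      "((\<lambda>t. Complex x t) has_vector_derivative \<i>) (at y)"
    proof -
      have eq: "(\<lambda>s. Complex s y) = (\<lambda>s. s *\<^sub>R 1 + Complex 0 y)"
        "(\<lambda>t. Complex x t) = (\<lambda>t. t *\<^sub>R \<i> + of_real x)"
        by (simp_all add: fun_eq_iff complex_eq_iff)
      show "((\<lambda>s. Complex s y) has_vector_derivative 1) (at x)"
        "((\<lambda>t. Complex x t) has_vector_derivative \<i>) (at y)"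
        unfolding eq has_vector_derivative_def
        by (rule has_derivative_add_const, rule bounded_linear_imp_has_derivative, rule bounded_linear_scaleR_left)+
    qed
    from der[OF this(1) z] der[OF this(2) z]
    show "((\<lambda>s. f (slice_point I s y)) has_vector_derivative D (Complex (fst (x, y)) (snd (x, y)))) (at x)"
      "((\<lambda>t. f (slice_point I x t)) has_vector_derivative I * D (Complex (fst (x, y)) (snd (x, y)))) (at y)"
      by (simp_all add: slice_point_emb) (simp add: slice_emb_alt)
    show "(1/2) *\<^sub>R (D (Complex (fst (x, y)) (snd (x, y))) + I * (I * D (Complex (fst (x, y)) (snd (x, y))))) = 0"
      by (simp add: imag_unitsD(1)[OF I] flip: mult.assoc)
  qed
qed

text \<open>The conjugate of \<open>exp (t I)\<close> is \<open>exp (- t I)\<close>, its inverse.\<close>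

lemma norm_exp_imag_unit:
  assumes "I \<in> \<S>"
  shows "norm (exp (t *\<^sub>R I)) = 1"
proof -
  have "(\<lambda>n. cnjq ((t *\<^sub>R I) ^ n /\<^sub>R fact n)) sums cnjq (exp (t *\<^sub>R I))"
    by (rule sums_cnjq[OF exp_converges])
  moreover have "cnjq (r *\<^sub>R q) = r *\<^sub>R cnjq q" for r q by (simp add: quat_eq_iff)
  then have "cnjq ((t *\<^sub>R I) ^ n /\<^sub>R fact n) = (- (t *\<^sub>R I)) ^ n /\<^sub>R fact n" for n
    unfolding scaleR_minus_right[symmetric]
    by (simp add: cnjq_power imag_unitsD[OF assms] del: scaleR_minus_right)
  ultimately have "cnjq (exp (t *\<^sub>R I)) = exp (- (t *\<^sub>R I))"
    using exp_converges[of "- (t *\<^sub>R I)"] by (simp add: sums_unique2)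
  then have "of_real ((norm (exp (t *\<^sub>R I)))\<^sup>2) = (1 :: quat)"
    using exp_minus_inverse[of "t *\<^sub>R I"] cnjq_mult_self(2)[of "exp (t *\<^sub>R I)"] by metis
  then have "(norm (exp (t *\<^sub>R I)))\<^sup>2 = 1" by (metis of_real_eq_1_iff)
  then show ?thesis using norm_ge_zero[of "exp (t *\<^sub>R I)"] by (simp only: power2_eq_1_iff) linarith
qed

text \<open>A function with absolutely summable coefficients is bounded on the ball.\<close>

lemma expands_slice_hardy:
  assumes f: "expands f F"
  shows "f \<in> slice_hardy"
proof -
  define I where "I = Quat 0 1 0 0"
  have I: "I \<in> \<S>" by (simp add: I_def imag_units_def quat_eq_iff power2_eq_square)
  define C where "C = (\<Sum>n. norm (fps_nth F n))"
  have le: "norm (f q) \<le> C" if "q \<in> \<B>" for q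
    using f that norm_power_series_le(2)[of "fps_nth F" q] by (simp add: expands_def summable_fps_def C_def sums_iff)
  have "1 / (2 * pi) * integral {0..2 * pi} (\<lambda>t. (norm (f (r *\<^sub>R exp (t *\<^sub>R I))))\<^sup>2) \<le> C\<^sup>2"
    if r: "r \<in> {0..<1}" for r :: real
  proof -
    let ?h = "\<lambda>t. (norm (f (r *\<^sub>R exp (t *\<^sub>R I))))\<^sup>2"
    have h: "?h t \<le> C\<^sup>2" for t
      using r by (intro power_mono le) (simp_all add: norm_exp_imag_unit[OF I])
    have "integral {0..2 * pi} ?h \<le> 2 * pi * C\<^sup>2"
    proof (cases "?h integrable_on {0..2 * pi}")
      case True
      then have "integral {0..2 * pi} ?h \<le> integral {0..2 * pi} (\<lambda>_. C\<^sup>2)"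
        by (intro integral_le) (use h in auto)
      then show ?thesis by simp
    next
      case False
      then show ?thesis by (simp add: not_integrable_integral)
    qed
    then show ?thesis by (simp add: field_simps)
  qed
  then show ?thesis
    unfolding slice_hardy_def using I expands_slice_regular[OF f]
    by (auto intro!: bexI[of _ I] bdd_aboveI[of _ "C\<^sup>2"])
qed

text \<open>The series converges uniformly on the closed ball and is therefore continuous there.\<close>

lemma radial_limit_expands:
  assumes f: "expands f F" and q: "norm q = 1"
  shows "radial_limit f q = (\<Sum>n. q ^ n * fps_nth F n)"
proof -
  let ?G = "\<lambda>q. \<Sum>n. q ^ n * fps_nth F n"
  have s: "summable (\<lambda>n. norm (fps_nth F n))" using f by (simp add: expands_def summable_fps_def)
  have "uniform_limit (cball 0 1) (\<lambda>n q. \<Sum>i<n. q ^ i * fps_nth F i) ?G sequentially"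
    by (rule Weierstrass_m_test[OF _ s])
      (simp add: norm_mult norm_power mult_left_le_one_le power_le_one)
  then have G: "continuous_on (cball 0 1) ?G"
    by (rule uniform_limit_theorem[rotated]) (auto intro!: always_eventually continuous_intros)
  have "continuous_on {0..1} (\<lambda>r. ?G (r *\<^sub>R q))"
    by (rule continuous_on_compose2[OF G]) (auto intro!: continuous_intros simp: q)
  then have "((\<lambda>r. ?G (r *\<^sub>R q)) \<longlongrightarrow> ?G (1 *\<^sub>R q)) (at 1 within {0..1})"
    unfolding continuous_on_def by (rule bspec) simp
  then have lim: "((\<lambda>r. ?G (r *\<^sub>R q)) \<longlongrightarrow> ?G q) (at_left 1)"
    by (simp add: at_within_Icc_at_left)
  have "\<forall>\<^sub>F r in at_left (1::real). r \<in> {0<..<1}"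
    by (rule eventually_at_leftI[of 0]) auto
  then have "\<forall>\<^sub>F r in at_left 1. ?G (r *\<^sub>R q) = f (r *\<^sub>R q)"
  proof eventually_elim
    case (elim r)
    then have "r *\<^sub>R q \<in> \<B>" using q by simp
    then have "(\<lambda>n. (r *\<^sub>R q) ^ n * fps_nth F n) sums f (r *\<^sub>R q)"
      using f unfolding expands_def by blast
    then show ?case by (rule sums_unique[symmetric])
  qed
  from Lim_transform_eventually[OF lim this] show ?thesis
    unfolding radial_limit_def by (intro tendsto_Lim) simp_all
qed

lemma hardy_inner_expands:
  assumes f: "expands f F" and g: "expands g G"
  shows "(\<lambda>n. cnjq (fps_nth G n) * fps_nth F n) sums hardy_inner f g"
proof -
  let ?h = "\<lambda>q. cnjq (\<Sum>n. q ^ n * fps_nth G n) * (\<Sum>n. q ^ n * fps_nth F n)"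
  have [measurable]: "?h \<in> borel_measurable borel"
    by (intro borel_measurable_times) measurable
  have "hardy_inner f g = (1 / (4 * pi\<^sup>2)) *\<^sub>R (LINT q|sphere_measure. (1 / (norm (Imq q))\<^sup>2) *\<^sub>R ?h q)"
    unfolding hardy_inner_def
    by (intro arg_cong[where f = "scaleR _"] Bochner_Integration.integral_cong)
      (simp_all add: radial_limit_expands[OF f] radial_limit_expands[OF g])
  also have "\<dots> = (LINT q|sphere_measure. (1 / (4 * pi\<^sup>2 * (norm (Imq q))\<^sup>2)) *\<^sub>R ?h q)"
    by (subst integral_scaleR_right[symmetric]) simp
  also have "\<dots> = (\<integral>q. ?h q \<partial>slice_measure)"
    unfolding slice_measure_def
    by (rule integral_density[symmetric]) (auto intro!: measurable_sphere_measure AE_I2)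
  finally show ?thesis
    using slice_Parseval[of "fps_nth F" "fps_nth G"] f g by (simp add: expands_def summable_fps_def)
qed

section \<open>Blaschke factors as isometries\<close>

definition fps_inner :: "quat fps \<Rightarrow> quat fps \<Rightarrow> quat"
  where "fps_inner F G = (\<Sum>n. cnjq (fps_nth G n) * fps_nth F n)"

lemma fps_inner_sums:
  assumes "summable_fps F" "summable_fps G"
  shows "(\<lambda>n. cnjq (fps_nth G n) * fps_nth F n) sums fps_inner F G"
  using slice_Parseval[of "fps_nth F" "fps_nth G"] assms
  by (simp add: summable_fps_def fps_inner_def sums_iff)

lemma fps_inner_commute:
  assumes "summable_fps F" "summable_fps G"
  shows "fps_inner G F = cnjq (fps_inner F G)"
proof -
  have "(\<lambda>n. cnjq (cnjq (fps_nth G n) * fps_nth F n)) sums cnjq (fps_inner F G)"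
    by (rule sums_cnjq[OF fps_inner_sums[OF assms]])
  then show ?thesis using fps_inner_sums[OF assms(2,1)] by (simp add: sums_unique2)
qed

lemma hardy_inner_eq_fps_inner:
  assumes "expands f F" "expands g G"
  shows "hardy_inner f g = fps_inner F G"
  using hardy_inner_expands[OF assms] fps_inner_sums[of F G] assms
  by (auto simp: expands_def intro: sums_unique2)

lemma summable_fps_const: "summable_fps (fps_const c)"
  by (rule summable_fps_finite_support[where N = 0]) simp

lemma summable_fps_blaschke: "a \<in> \<B> \<Longrightarrow> summable_fps (blaschke_fps a)"
  using expands_blaschke_factor by (simp add: expands_def)

lemma summable_fps_szego: "a \<in> \<B> \<Longrightarrow> summable_fps (szego_fps a)"
  using expands_szego_kernel by (simp add: expands_def)

lemma summable_fps_tendsto_0: "summable_fps F \<Longrightarrow> fps_nth F \<longlonglongrightarrow> 0"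
  unfolding summable_fps_def by (rule tendsto_norm_zero_cancel[OF summable_LIMSEQ_zero])

lemma norm_blaschke_unit: "norm (blaschke_unit a) = 1"
  by (simp add: blaschke_unit_def)

lemma mult_cnjq_cancel:
  "a * (cnjq a * x) = (norm a)\<^sup>2 *\<^sub>R x" "cnjq a * (a * x) = (norm a)\<^sup>2 *\<^sub>R x"
  by (simp_all add: cnjq_mult_self scaleR_conv_of_real flip: mult.assoc)

lemma cnjq_diff: "cnjq (x - y) = cnjq x - cnjq y"
  by (simp add: quat_eq_iff)

text \<open>The telescoping quantity: the coefficients of \<open>B\<^sub>a * F - a u F\<close>. By the identity
  \<open>(1 - q a') * (B\<^sub>a * F) = (a - q) * u F\<close> this series is also \<open>q (a' (B\<^sub>a * F) - u F)\<close>, where \<open>a'\<close> is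
  the conjugate of \<open>a\<close> and \<open>u\<close> the unit of the Blaschke factor.\<close>

definition blaschke_defect :: "quat \<Rightarrow> quat fps \<Rightarrow> nat \<Rightarrow> quat"
  where "blaschke_defect a F n =
    fps_nth (blaschke_fps a * F) n - a * (blaschke_unit a * fps_nth F n)"

lemma blaschke_fps_recurrence:
  "linear_fps 1 (- cnjq a) * (blaschke_fps a * F) = linear_fps a (- 1) * (fps_const (blaschke_unit a) * F)"
proof -
  have "linear_fps 1 (- cnjq a) * (blaschke_fps a * F)
      = (linear_fps 1 (- cnjq a) * geometric_fps a) * (linear_fps a (- 1) * (fps_const (blaschke_unit a) * F))"
    by (simp only: blaschke_fps_def mult.assoc)
  then show ?thesis by (simp add: linear_geometric_fps)
qed

lemma blaschke_defect_0: "blaschke_defect a F 0 = 0"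
  using arg_cong[OF blaschke_fps_recurrence, of "\<lambda>F. fps_nth F 0" a F]
  unfolding blaschke_defect_def linear_fps_mult_nth by simp

lemma blaschke_defect_Suc:
  "blaschke_defect a F (Suc n) = cnjq a * fps_nth (blaschke_fps a * F) n - blaschke_unit a * fps_nth F n"
  using arg_cong[OF blaschke_fps_recurrence, of "\<lambda>F. fps_nth F (Suc n)" a F]
  unfolding blaschke_defect_def linear_fps_mult_nth by (simp add: algebra_simps)

lemma blaschke_defect_tendsto_0:
  assumes "a \<in> \<B>" "summable_fps F"
  shows "blaschke_defect a F \<longlonglongrightarrow> 0"
proof -
  have "(\<lambda>n. fps_nth (blaschke_fps a * F) n - a * (blaschke_unit a * fps_nth F n))
      \<longlonglongrightarrow> 0 - a * (blaschke_unit a * 0)"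
    by (intro tendsto_diff tendsto_mult tendsto_const summable_fps_tendsto_0 summable_fps_mult summable_fps_blaschke assms)
  then show ?thesis by (simp add: blaschke_defect_def[abs_def])
qed

text \<open>Polarised form of \<open>|d\<^sub>n\<^sub>+\<^sub>1|\<^sup>2 - |d\<^sub>n|\<^sup>2 = (1 - |a|\<^sup>2) (|f\<^sub>n|\<^sup>2 - |g\<^sub>n|\<^sup>2)\<close>, summed over \<open>n\<close>.\<close>

lemma fps_inner_blaschke_mult:
  assumes a: "a \<in> \<B>" and F: "summable_fps F" and G: "summable_fps G"
  shows "fps_inner (blaschke_fps a * F) (blaschke_fps a * G) = fps_inner F G"
proof -
  let ?u = "blaschke_unit a" and ?x = "blaschke_defect a F" and ?y = "blaschke_defect a G"
  let ?P = "blaschke_fps a * F" and ?Q = "blaschke_fps a * G"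
  have identity: "cnjq (cnjq a * g' - h') * (cnjq a * g - h) - cnjq (g' - a * h') * (g - a * h)
      = (1 - (norm a)\<^sup>2) *\<^sub>R (cnjq h' * h - cnjq g' * g)" for g g' h h'
    by (simp add: cnjq_diff algebra_simps mult_cnjq_cancel)
  have unit: "cnjq (?u * v) * (?u * w) = cnjq v * w" for v w
    by (simp add: mult.assoc mult_cnjq_cancel norm_blaschke_unit)
  have "(\<lambda>n. cnjq (?y n) * ?x n) \<longlonglongrightarrow> cnjq 0 * 0"
    by (intro tendsto_mult bounded_linear.tendsto[OF bounded_linear_cnjq] blaschke_defect_tendsto_0 assms)
  from telescope_sums[OF this]
  have "(\<lambda>n. cnjq (?y (Suc n)) * ?x (Suc n) - cnjq (?y n) * ?x n) sums 0"
    by (simp add: blaschke_defect_0)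
  moreover have "cnjq (?y (Suc n)) * ?x (Suc n) - cnjq (?y n) * ?x n
      = (1 - (norm a)\<^sup>2) *\<^sub>R (cnjq (fps_nth G n) * fps_nth F n - cnjq (fps_nth ?Q n) * fps_nth ?P n)" for n
    unfolding blaschke_defect_Suc unfolding blaschke_defect_def identity unit ..
  moreover have "(\<lambda>n. (1 - (norm a)\<^sup>2) *\<^sub>R (cnjq (fps_nth G n) * fps_nth F n - cnjq (fps_nth ?Q n) * fps_nth ?P n))
      sums ((1 - (norm a)\<^sup>2) *\<^sub>R (fps_inner F G - fps_inner ?P ?Q))"
    by (intro sums_scaleR_right sums_diff fps_inner_sums F G summable_fps_mult summable_fps_blaschke a)
  ultimately have "(1 - (norm a)\<^sup>2) *\<^sub>R (fps_inner F G - fps_inner ?P ?Q) = 0"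
    by (simp only:) (rule sums_unique2)
  moreover have "1 - (norm a)\<^sup>2 \<noteq> 0"
    using a by (simp add: power2_eq_1_iff) (use norm_ge_zero[of a] in linarith)
  ultimately show ?thesis by simp
qed

lemma cnjq_szego_nth:
  "cnjq (fps_nth (szego_fps a) n) = sqrt (1 - (norm a)\<^sup>2) *\<^sub>R a ^ n"
proof -
  have "cnjq (r *\<^sub>R q) = r *\<^sub>R cnjq q" for r q by (simp add: quat_eq_iff)
  then show ?thesis
    by (simp add: szego_fps_def geometric_fps_def cnjq_power flip: scaleR_conv_of_real)
qed

text \<open>The inner product with the Szego kernel of \<open>a\<close> is a multiple of the sum of \<open>a ^ n g\<^sub>n\<close>, the
  value at \<open>a\<close>; the series telescopes through \<open>a ^ n d\<^sub>n\<close>.\<close>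

lemma fps_inner_blaschke_szego:
  assumes a: "a \<in> \<B>" and F: "summable_fps F"
  shows "fps_inner (blaschke_fps a * F) (szego_fps a) = 0"
proof -
  let ?x = "blaschke_defect a F" and ?P = "blaschke_fps a * F" and ?s = "sqrt (1 - (norm a)\<^sup>2)"
  have "norm (a ^ n * ?x n) \<le> norm (?x n)" for n
    using a by (simp add: norm_mult norm_power mult_left_le_one_le power_le_one)
  then have "(\<lambda>n. a ^ n * ?x n) \<longlonglongrightarrow> 0"
    by (intro Lim_null_comparison[OF always_eventually tendsto_norm_zero[OF blaschke_defect_tendsto_0[OF a F]]]) simp
  from telescope_sums[OF this]
  have "(\<lambda>n. a ^ Suc n * ?x (Suc n) - a ^ n * ?x n) sums 0"
    by (simp add: blaschke_defect_0)
  moreover have "a ^ Suc n * ?x (Suc n) - a ^ n * ?x n = ((norm a)\<^sup>2 - 1) *\<^sub>R (a ^ n * fps_nth ?P n)" for n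
  proof -
    have "a ^ Suc n * ?x (Suc n) - a ^ n * ?x n = a ^ n * (a * ?x (Suc n) - ?x n)"
      unfolding power_Suc2 by (simp only: mult.assoc right_diff_distrib)
    also have "a * ?x (Suc n) - ?x n = ((norm a)\<^sup>2 - 1) *\<^sub>R fps_nth ?P n"
      unfolding blaschke_defect_Suc unfolding blaschke_defect_def
      by (simp add: algebra_simps mult_cnjq_cancel)
    finally show ?thesis by simp
  qed
  ultimately have "(\<lambda>n. ((norm a)\<^sup>2 - 1) *\<^sub>R (a ^ n * fps_nth ?P n)) sums 0" by simp
  from sums_scaleR_right[OF this, of "?s / ((norm a)\<^sup>2 - 1)"]
  have "(\<lambda>n. (?s / ((norm a)\<^sup>2 - 1)) *\<^sub>R (((norm a)\<^sup>2 - 1) *\<^sub>R (a ^ n * fps_nth ?P n))) sums 0"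
    by (simp only: scaleR_zero_right)
  moreover have "(norm a)\<^sup>2 \<noteq> 1"
    using a by (simp add: power2_eq_1_iff) (use norm_ge_zero[of a] in linarith)
  ultimately have "(\<lambda>n. cnjq (fps_nth (szego_fps a) n) * fps_nth ?P n) sums 0"
    by (simp add: cnjq_szego_nth)
  then show ?thesis by (simp add: fps_inner_def sums_iff)
qed

lemma fps_inner_szego_szego:
  assumes a: "a \<in> \<B>"
  shows "fps_inner (szego_fps a) (szego_fps a) = 1"
proof -
  have n: "norm a < 1" using a by simp
  then have "(norm a)\<^sup>2 < 1" by (simp add: abs_square_less_1)
  then have "(\<lambda>n. (1 - (norm a)\<^sup>2) * ((norm a)\<^sup>2) ^ n) sums ((1 - (norm a)\<^sup>2) * (1 / (1 - (norm a)\<^sup>2)))"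
    by (intro sums_mult geometric_sums) simp
  then have "(\<lambda>n. (1 - (norm a)\<^sup>2) * ((norm a)\<^sup>2) ^ n) sums 1"
    using \<open>(norm a)\<^sup>2 < 1\<close> by simp
  then have "(\<lambda>n. of_real ((1 - (norm a)\<^sup>2) * ((norm a)\<^sup>2) ^ n)) sums (of_real 1 :: quat)"
    by (rule sums_of_real)
  moreover have "of_real ((1 - (norm a)\<^sup>2) * ((norm a)\<^sup>2) ^ n)
      = cnjq (fps_nth (szego_fps a) n) * fps_nth (szego_fps a) n" for n
  proof -
    have "(norm (fps_nth (szego_fps a) n))\<^sup>2 = (1 - (norm a)\<^sup>2) * ((norm a)\<^sup>2) ^ n"
      using \<open>(norm a)\<^sup>2 < 1\<close>
      by (simp add: szego_fps_def geometric_fps_def norm_mult norm_power power_mult_distrib flip: power_mult)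
        (simp add: mult.commute)
    then show ?thesis by (simp only: cnjq_mult_self)
  qed
  ultimately show ?thesis by (simp add: fps_inner_def sums_iff)
qed

text \<open>By associativity the factors act one after the other from the left, and each is isometric.\<close>

lemma fps_inner_blaschke_product_mult:
  assumes a: "\<And>k. k \<ge> 1 \<Longrightarrow> a k \<in> \<B>" and "summable_fps F" "summable_fps G"
  shows "fps_inner (blaschke_product_fps a n * F) (blaschke_product_fps a n * G) = fps_inner F G"
  using assms(2,3)
proof (induction n arbitrary: F G)
  case (Suc n)
  have b: "a (Suc n) \<in> \<B>" by (rule a) simp
  have "fps_inner (blaschke_product_fps a (Suc n) * F) (blaschke_product_fps a (Suc n) * G)
      = fps_inner (blaschke_fps (a (Suc n)) * F) (blaschke_fps (a (Suc n)) * G)"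
    unfolding blaschke_product_fps.simps mult.assoc
    by (intro Suc.IH summable_fps_mult summable_fps_blaschke b Suc.prems)
  then show ?case using fps_inner_blaschke_mult[OF b Suc.prems] by simp
qed simp

lemma blaschke_product_fps_split:
  assumes a: "\<And>k. k \<ge> 1 \<Longrightarrow> a k \<in> \<B>" and "k < n"
  shows "\<exists>R. summable_fps R \<and>
    blaschke_product_fps a n = blaschke_product_fps a k * (blaschke_fps (a (Suc k)) * R)"
proof -
  from \<open>k < n\<close> have "Suc k \<le> n" by simp
  then show ?thesis
  proof (induction n rule: dec_induct)
    case base
    have "summable_fps 1" using summable_fps_const[of 1] by simp
    then show ?case by (intro exI[of _ 1]) simp
  next
    case (step n)
    then obtain R where R: "summable_fps R"
      "blaschke_product_fps a n = blaschke_product_fps a k * (blaschke_fps (a (Suc k)) * R)" by blast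
    have "summable_fps (R * blaschke_fps (a (Suc n)))"
      by (intro summable_fps_mult R(1) summable_fps_blaschke a) simp
    then show ?case by (intro exI[of _ "R * blaschke_fps (a (Suc n))"]) (simp add: R(2) mult.assoc)
  qed
qed

text \<open>The product of the first \<open>l - 1\<close> Blaschke factors starts with those of \<open>T\<^sub>k\<close>, followed by the
  factor of \<open>a\<^sub>k\<close>; cancelling the common part leaves an inner product of the shape
  \<open>\<langle>B\<^sub>a * F, e\<^sub>a\<rangle>\<close>.\<close>

lemma fps_inner_TM_function_less:
  assumes a: "\<And>k. k \<ge> 1 \<Longrightarrow> a k \<in> \<B>" and kl: "1 \<le> k" "k < l"
  shows "fps_inner (blaschke_product_fps a (l - 1) * szego_fps (a l))
    (blaschke_product_fps a (k - 1) * szego_fps (a k)) = 0"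
proof -
  have k: "Suc (k - 1) = k" using kl by simp
  have ak: "a k \<in> \<B>" and al: "a l \<in> \<B>" by (rule a, use kl in simp)+
  have "k - 1 < l - 1" using kl by simp
  from blaschke_product_fps_split[where a = a, OF a this] obtain R where R: "summable_fps R"
    "blaschke_product_fps a (l - 1) = blaschke_product_fps a (k - 1) * (blaschke_fps (a k) * R)"
    unfolding k by blast
  have RS: "summable_fps (R * szego_fps (a l))" by (intro summable_fps_mult R(1) summable_fps_szego al)
  have "fps_inner (blaschke_product_fps a (l - 1) * szego_fps (a l))
      (blaschke_product_fps a (k - 1) * szego_fps (a k))
      = fps_inner (blaschke_fps (a k) * (R * szego_fps (a l))) (szego_fps (a k))"
    unfolding R(2) mult.assoc
    by (intro fps_inner_blaschke_product_mult a summable_fps_mult summable_fps_blaschke summable_fps_szego ak al R(1))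
  then show ?thesis using fps_inner_blaschke_szego[OF ak RS] by simp
qed

theorem theorem3p6:
  fixes a :: "nat \<Rightarrow> quat"
  assumes "\<And>k. k \<ge> 1 \<Longrightarrow> a k \<in> \<B>"
  shows "(\<forall>k\<ge>1. TM_function a k \<in> slice_hardy) \<and>
    (\<forall>k\<ge>1. hardy_inner (TM_function a k) (TM_function a k) = 1) \<and>
    (\<forall>k\<ge>1. \<forall>l\<ge>1. k \<noteq> l \<longrightarrow> hardy_inner (TM_function a k) (TM_function a l) = 0)"
proof -
  define T where "T k = blaschke_product_fps a (k - 1) * szego_fps (a k)" for k
  have T: "expands (TM_function a k) (T k)" if "k \<ge> 1" for k
    unfolding T_def by (rule expands_TM_function[OF assms that])
  then have abs: "summable_fps (T k)" if "k \<ge> 1" for k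
    using that by (simp add: expands_def)
  have inner: "hardy_inner (TM_function a k) (TM_function a l) = fps_inner (T k) (T l)"
    if "k \<ge> 1" "l \<ge> 1" for k l
    by (rule hardy_inner_eq_fps_inner[OF T[OF that(1)] T[OF that(2)]])
  have norm: "fps_inner (T k) (T k) = 1" if "k \<ge> 1" for k
    unfolding T_def using assms[OF that]
    by (simp add: fps_inner_blaschke_product_mult[OF assms] summable_fps_szego fps_inner_szego_szego)
  have less: "fps_inner (T l) (T k) = 0" if "1 \<le> k" "k < l" for k l
    unfolding T_def by (rule fps_inner_TM_function_less[OF assms that])
  have orth: "fps_inner (T k) (T l) = 0" if "k \<ge> 1" "l \<ge> 1" "k \<noteq> l" for k l
  proof (cases "k < l")
    case True
    have "cnjq 0 = 0" by (simp add: quat_eq_iff)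
    then show ?thesis
      using fps_inner_commute[OF abs[OF that(2)] abs[OF that(1)]] less[OF that(1) True] by simp
  next
    case False
    then show ?thesis using that less by simp
  qed
  show ?thesis
    using T expands_slice_hardy inner norm orth by auto
qed

end
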